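(* Let $d_1,d_2\ge1$ be integers and let $\boldsymbol\kappa=(\kappa_1,\dots,\kappa_{d_2+1})\in\mathbb{R}^{d_2+1}$ with $\kappa_i>-1$ for $1\le i\le d_2+1$. Define the fourth-order differential operator $$ \begin{aligned} \mathfrak{D}_{\boldsymbol\kappa}^{\mathbb{R}\rtimes\triangle}u:={}&-\tfrac14(1-|y|)^3\Delta_x^2u+(1-|y|)\langle x,\nabla_x\rangle\Delta_xu-\big(\langle x,\nabla_x\rangle+\langle y,\nabla_y\rangle\big)^2u\\ &+\Big(1+\tfrac12(\kappa_{d_2+1}+d_1)\Big)(1-|y|)\Delta_xu+\sum_{i=1}^{d_2}\big[y_i\partial_{y_i}^2+(\kappa_i+1)\partial_{y_i}\big]u\\ &-(|\boldsymbol\kappa|+d_1+d_2)\big(\langle x,\nabla_x\rangle+\langle y,\nabla_y\rangle\big)u . \end{aligned} $$ Then, for each $n\in\mathbb{N}_0$, $\mathcal{V}_n\big(\mathbb{R}^{d_1}\rtimes\triangle^{d_2},W_{\boldsymbol\kappa}^{\mathbb{R}\rtimes\triangle}\big)$ is an eigenspace of $\mathfrak{D}_{\boldsymbol\kappa}^{\mathbb{R}\rtimes\triangle}$; more precisely, $$ \mathfrak{D}_{\boldsymbol\kappa}^{\mathbb{R}\rtimes\triangle}u=-n(n+|\boldsymbol\kappa|+d_1+d_2)u\qquad\text{for all }u\in\mathcal{V}_n\big(\mathbb{R}^{d_1}\rtimes\triangle^{d_2},W_{\boldsymbol\kappa}^{\mathbb{R}\rtimes\triangle}\big). $$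
   Context: Variables are $(x,y)\in\mathbb{R}^{d_1}\times\mathbb{R}^{d_2}$; $\|x\|$ is the Euclidean norm, $|y|=y_1+\dots+y_{d_2}$, $|\boldsymbol\kappa|=\kappa_1+\dots+\kappa_{d_2+1}$; $\Delta_x$ is the Laplacian in $x$, $\langle x,\nabla_x\rangle=\sum_ix_i\partial_{x_i}$, $\langle y,\nabla_y\rangle=\sum_iy_i\partial_{y_i}$, and products and powers of operators mean composition. $\triangle^{d}=\{y\in\mathbb{R}^d:y_1\ge0,\dots,y_d\ge0,\ |y|\le1\}$. The domain is $\mathbb{R}^{d_1}\rtimes\triangle^{d_2}=\mathbb{R}^{d_1}\times\triangle^{d_2}$ with weight $W_{\boldsymbol\kappa}^{\mathbb{R}\rtimes\triangle}(x,y)=\prod_{i=1}^{d_2}y_i^{\kappa_i}(1-|y|)^{\kappa_{d_2+1}}\exp\!\big(-\tfrac{\|x\|^2}{(1-|y|)^2}\big)$. For a weight $W$ on $\Omega$, $\mathcal{V}_n(\Omega,W)$ is the space of real polynomials of degree $n$ (together with $0$) orthogonal to all polynomials of degree less than $n$ with respect to $\int_\Omega fg\,W$. *)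

theory Defs
  imports "HOL-Analysis.Analysis"
begin

section \<open>Polynomials on a Euclidean space and orthogonal polynomials\<close>

text \<open>
  Polynomials are represented by their polynomial functions. Multi-indices are functions on the
  standard basis, made extensional so that each one occurs exactly once in the sum; their entries
  are bounded by \<open>n\<close> only to make the index set visibly finite.
\<close>

definition multi_indices :: "nat \<Rightarrow> ('a::euclidean_space \<Rightarrow> nat) set" where
  "multi_indices n = {\<alpha> \<in> Basis \<rightarrow>\<^sub>E {..n}. (\<Sum>b\<in>Basis. \<alpha> b) \<le> n}"

definition monomial :: "('a::euclidean_space \<Rightarrow> nat) \<Rightarrow> 'a \<Rightarrow> real" where
  "monomial \<alpha> z = (\<Prod>b\<in>Basis. (z \<bullet> b) ^ \<alpha> b)"

definition polys_upto :: "nat \<Rightarrow> ('a::euclidean_space \<Rightarrow> real) set" where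
  "polys_upto n = {p. \<exists>c. p = (\<lambda>z. \<Sum>\<alpha>\<in>multi_indices n. c \<alpha> * monomial \<alpha> z)}"

text \<open>The zero polynomial is formally given degree \<open>0\<close> here.\<close>

definition poly_of_degree :: "nat \<Rightarrow> ('a::euclidean_space \<Rightarrow> real) \<Rightarrow> bool" where
  "poly_of_degree n p \<longleftrightarrow> p \<in> polys_upto n \<and> (\<forall>m<n. p \<notin> polys_upto m)"

definition weighted_inner ::
  "'a::euclidean_space set \<Rightarrow> ('a \<Rightarrow> real) \<Rightarrow> ('a \<Rightarrow> real) \<Rightarrow> ('a \<Rightarrow> real) \<Rightarrow> real" where
  "weighted_inner \<Omega> W f g = (LINT z:\<Omega>|lborel. f z * g z * W z)"

definition orth_polys :: "nat \<Rightarrow> 'a::euclidean_space set \<Rightarrow> ('a \<Rightarrow> real) \<Rightarrow> ('a \<Rightarrow> real) set" where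
  "orth_polys n \<Omega> W =
     {u. (poly_of_degree n u \<or> u = (\<lambda>z. 0)) \<and>
         (\<forall>m<n. \<forall>q. poly_of_degree m q \<longrightarrow> weighted_inner \<Omega> W u q = 0)}"

section \<open>The domain and the weight\<close>

definition ysum :: "real ^ 'd2 \<Rightarrow> real" where
  "ysum y = (\<Sum>i\<in>UNIV. y $ i)"

definition simplex_dom :: "(real ^ 'd) set" where
  "simplex_dom = {y. (\<forall>i. 0 \<le> y $ i) \<and> ysum y \<le> 1}"

definition rtri :: "((real ^ 'd1) \<times> (real ^ 'd2)) set" where
  "rtri = UNIV \<times> simplex_dom"

text \<open>
  The parameter vector has \<open>d2 + 1\<close> entries and is indexed by \<open>'d2 option\<close>:
  \<open>\<kappa> $ Some i\<close> belongs to the coordinate \<open>y $ i\<close>, and \<open>\<kappa> $ None\<close> is the last entry,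
  the exponent of \<open>1 - |y|\<close>. The conventions \<open>0 powr a = 0\<close> and \<open>t / 0 = 0\<close> affect the
  weight only on the boundary of the simplex, a null set.
\<close>

definition rtri_weight ::
  "real ^ ('d2::finite option) \<Rightarrow> (real ^ 'd1) \<times> (real ^ 'd2) \<Rightarrow> real" where
  "rtri_weight \<kappa> = (\<lambda>(x, y).
     (\<Prod>i\<in>UNIV. (y $ i) powr (\<kappa> $ Some i)) * (1 - ysum y) powr (\<kappa> $ None)
     * exp (- ((norm x)\<^sup>2 / (1 - ysum y)\<^sup>2)))"

definition kappa_sum :: "real ^ ('d2::finite option) \<Rightarrow> real" where
  "kappa_sum \<kappa> = (\<Sum>j\<in>UNIV. \<kappa> $ j)"

section \<open>The differential operators\<close>

definition dir_deriv :: "'a::real_normed_vector \<Rightarrow> ('a \<Rightarrow> real) \<Rightarrow> 'a \<Rightarrow> real" where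
  "dir_deriv v f z = deriv (\<lambda>t. f (z + t *\<^sub>R v)) 0"

definition dx ::
  "'d1::finite \<Rightarrow> ((real ^ 'd1) \<times> (real ^ 'd2) \<Rightarrow> real) \<Rightarrow> (real ^ 'd1) \<times> (real ^ 'd2) \<Rightarrow> real" where
  "dx i = dir_deriv (axis i 1, 0)"

definition dy ::
  "'d2::finite \<Rightarrow> ((real ^ 'd1) \<times> (real ^ 'd2) \<Rightarrow> real) \<Rightarrow> (real ^ 'd1) \<times> (real ^ 'd2) \<Rightarrow> real" where
  "dy i = dir_deriv (0, axis i 1)"

definition laplace_x ::
  "((real ^ 'd1) \<times> (real ^ 'd2) \<Rightarrow> real) \<Rightarrow> (real ^ 'd1) \<times> (real ^ 'd2) \<Rightarrow> real" where
  "laplace_x f z = (\<Sum>i\<in>UNIV. dx i (dx i f) z)"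

definition euler_x ::
  "((real ^ 'd1) \<times> (real ^ 'd2) \<Rightarrow> real) \<Rightarrow> (real ^ 'd1) \<times> (real ^ 'd2) \<Rightarrow> real" where
  "euler_x f z = (\<Sum>i\<in>UNIV. fst z $ i * dx i f z)"

definition euler_y ::
  "((real ^ 'd1) \<times> (real ^ 'd2) \<Rightarrow> real) \<Rightarrow> (real ^ 'd1) \<times> (real ^ 'd2) \<Rightarrow> real" where
  "euler_y f z = (\<Sum>i\<in>UNIV. snd z $ i * dy i f z)"

definition euler_xy ::
  "((real ^ 'd1) \<times> (real ^ 'd2) \<Rightarrow> real) \<Rightarrow> (real ^ 'd1) \<times> (real ^ 'd2) \<Rightarrow> real" where
  "euler_xy f z = euler_x f z + euler_y f z"

definition rtri_op ::
  "real ^ ('d2::finite option) \<Rightarrow> ((real ^ 'd1) \<times> (real ^ 'd2) \<Rightarrow> real)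
     \<Rightarrow> (real ^ 'd1) \<times> (real ^ 'd2) \<Rightarrow> real" where
  "rtri_op \<kappa> u = (\<lambda>(x, y).
     - (1/4) * (1 - ysum y) ^ 3 * laplace_x (laplace_x u) (x, y)
     + (1 - ysum y) * euler_x (laplace_x u) (x, y)
     - euler_xy (euler_xy u) (x, y)
     + (1 + (1/2) * (\<kappa> $ None + real CARD('d1))) * (1 - ysum y) * laplace_x u (x, y)
     + (\<Sum>i\<in>UNIV. y $ i * dy i (dy i u) (x, y) + (\<kappa> $ Some i + 1) * dy i u (x, y))
     - (kappa_sum \<kappa> + real CARD('d1) + real CARD('d2)) * euler_xy u (x, y))"

end

theory Submission
  imports Defs "HOL-Probability.Distributions" "HOL-Real_Asymp.Real_Asymp"
begin

text \<open>
  Write \<open>D\<close> for the operator, \<open>t = 1 - |y|\<close> and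
  \<open>\<lambda> = n (n + |\<kappa>| + d\<^sub>1 + d\<^sub>2)\<close>. Two facts give the theorem. First, \<open>D\<close> does not raise
  degrees and acts on the part of degree \<open>n\<close> as \<open>- \<lambda>\<close>, because all its
  terms except those in the Euler operator lower the degree (\<open>rtri_op_leading_part\<close>). Secondly,
  \<open>D\<close> is symmetric on polynomials for the weighted inner product (\<open>M_rtri_op_sym\<close>). Now
  let \<open>u\<close> be an orthogonal polynomial of degree \<open>n\<close> and \<open>r = D u + \<lambda> u\<close>. Then
  \<open>r\<close> and \<open>D r\<close> have degree below \<open>n\<close>, so
  \<open>\<langle>r, r\<rangle> = \<langle>D u, r\<rangle> + \<lambda> \<langle>u, r\<rangle> = \<langle>u, D r\<rangle> + \<lambda> \<langle>u, r\<rangle> = 0\<close>, and \<open>r\<close> is zero.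

  The symmetry becomes visible in the variables \<open>\<xi> = x / t\<close> and \<open>y\<close>, in which the weight
  separates into a Gaussian in \<open>\<xi>\<close> and a Dirichlet density in \<open>y\<close>. With the
  Hermite operator \<open>L = \<Delta>\<^sub>\<xi> / 2 - \<langle>\<xi>, \<nabla>\<^sub>\<xi>\<rangle>\<close>, the Jacobi operator \<open>J\<close> of the simplex
  acting at fixed \<open>\<xi>\<close>, and \<open>c = \<kappa> $ None + d\<^sub>1\<close>, one has
  \<open>D = J - (L\<^sup>2 - c L) / t\<close>, and \<open>J\<close> and \<open>L\<close> are both symmetric. The proof does not
  change variables. It uses the identity multiplied by \<open>t\<close>
  (\<open>slack_rtri_op\<close>), in which all operators map polynomials in \<open>x\<close> and \<open>y\<close> to
  polynomials, and compensates by dividing the weight by \<open>t\<close>, which leaves it integrable since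
  \<open>d\<^sub>1 \<ge> 1\<close> (\<open>integrable_rho\<close>).

  The symmetry of \<open>L\<close> and \<open>t J\<close> for the divided weight follows algebraically from one
  integration-by-parts rule for each variable (\<open>rho_integral_dx\<close>, \<open>rho_integral_dy\<close>). These
  rest on a single principle: the integral of a directional derivative over the whole space is zero
  (\<open>integral_zero_of_line_primitive\<close>), applied to the weight extended by zero.
\<close>

section \<open>Polynomial functions with a degree bound\<close>

text \<open>
  The degree bound is an integer so that every derivative lowers it by one and every coordinate
  factor raises it by one, with no truncation at zero: below zero only the zero polynomial is left
  (\<open>poly_deg_neg\<close>). The closure rules replace explicit coefficient sums, and each
  fact about degrees below is a short rule induction.
\<close>

inductive poly_deg :: "int \<Rightarrow> ('a::euclidean_space \<Rightarrow> real) \<Rightarrow> bool" where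
  zero: "poly_deg k (\<lambda>z. 0)"
| const: "0 \<le> k \<Longrightarrow> poly_deg k (\<lambda>z. c)"
| add: "poly_deg k f \<Longrightarrow> poly_deg k g \<Longrightarrow> poly_deg k (\<lambda>z. f z + g z)"
| coord: "poly_deg k f \<Longrightarrow> b \<in> Basis \<Longrightarrow> poly_deg (k + 1) (\<lambda>z. (z \<bullet> b) * f z)"

definition polyfun :: "('a::euclidean_space \<Rightarrow> real) \<Rightarrow> bool" where
  "polyfun f \<longleftrightarrow> (\<exists>k. poly_deg k f)"

lemma poly_deg_cong: "poly_deg k f \<Longrightarrow> (\<And>z. f z = g z) \<Longrightarrow> poly_deg k g"
  by (metis ext)

text \<open>
  In the coordinate step the bound \<open>l\<close> need not have the form \<open>k + 1\<close>; the
  induction hypothesis is used at \<open>l - 1\<close>, which is available because bounds may be negative.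
\<close>

lemma poly_deg_mono: "poly_deg k f \<Longrightarrow> k \<le> l \<Longrightarrow> poly_deg l f"
proof (induction arbitrary: l rule: poly_deg.induct)
  case (coord k f b)
  then have "poly_deg ((l - 1) + 1) (\<lambda>z. (z \<bullet> b) * f z)"
    by (intro poly_deg.coord) auto
  then show ?case by simp
qed (auto intro: poly_deg.intros)

lemma poly_deg_cmult: "poly_deg k f \<Longrightarrow> poly_deg k (\<lambda>z. c * f z)"
proof (induction rule: poly_deg.induct)
  case (add k f g)
  then show ?case by (auto simp: distrib_left intro: poly_deg.add)
next
  case (coord k f b)
  from poly_deg.coord[OF coord.IH coord.hyps(2)] show ?case
    by (simp add: mult.left_commute)
qed (auto intro: poly_deg.intros)

lemma poly_deg_mult:
  "poly_deg k f \<Longrightarrow> poly_deg l g \<Longrightarrow> poly_deg (k + l) (\<lambda>z. f z * g z)"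
proof (induction rule: poly_deg.induct)
  case (const k c)
  then show ?case using poly_deg_mono[OF poly_deg_cmult, of l g "k + l" c] by simp
next
  case (add k f g)
  then show ?case by (auto simp: distrib_right intro: poly_deg.add)
next
  case (coord k f b)
  from poly_deg.coord[OF coord.IH[OF coord.prems] coord.hyps(2)] show ?case
    by (simp add: mult.assoc algebra_simps)
qed (auto intro: poly_deg.intros)

lemma poly_deg_diff:
  assumes "poly_deg k f" "poly_deg k g"
  shows "poly_deg k (\<lambda>z. f z - g z)"
  using poly_deg.add[OF assms(1) poly_deg_cmult[OF assms(2), of "-1"]] by simp

lemma poly_deg_sum:
  "(\<And>i. i \<in> A \<Longrightarrow> poly_deg k (f i)) \<Longrightarrow> poly_deg k (\<lambda>z. \<Sum>i\<in>A. f i z)"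
  by (induction A rule: infinite_finite_induct) (auto intro: poly_deg.intros)

lemma poly_deg_inner_Basis: "b \<in> Basis \<Longrightarrow> poly_deg 1 (\<lambda>z. z \<bullet> b)"
  using poly_deg.coord[OF poly_deg.const[of 0 1]] by simp

lemma poly_deg_neg: "poly_deg k f \<Longrightarrow> k < 0 \<Longrightarrow> f = (\<lambda>z. 0)"
  by (induction rule: poly_deg.induct) auto

named_theorems polyfun_intros

lemma polyfunI: "poly_deg k f \<Longrightarrow> polyfun f"
  by (auto simp: polyfun_def)

lemma polyfun_const [polyfun_intros]: "polyfun (\<lambda>z. c)"
  by (rule polyfunI[OF poly_deg.const[of 0]]) simp

lemma polyfun_add [polyfun_intros]:
  assumes "polyfun f" "polyfun g" shows "polyfun (\<lambda>z. f z + g z)"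
proof -
  from assms obtain k l where "poly_deg k f" "poly_deg l g" by (auto simp: polyfun_def)
  then have "poly_deg (max k l) f" "poly_deg (max k l) g" by (auto intro: poly_deg_mono)
  then show ?thesis by (intro polyfunI[OF poly_deg.add])
qed

lemma polyfun_mult [polyfun_intros]: "polyfun f \<Longrightarrow> polyfun g \<Longrightarrow> polyfun (\<lambda>z. f z * g z)"
  unfolding polyfun_def by (blast intro: poly_deg_mult)

lemma polyfun_diff [polyfun_intros]: "polyfun f \<Longrightarrow> polyfun g \<Longrightarrow> polyfun (\<lambda>z. f z - g z)"
  using polyfun_add[of f "\<lambda>z. (-1) * g z"] polyfun_mult[OF polyfun_const[of "-1"], of g] by simp

lemma polyfun_sum [polyfun_intros]:
  "(\<And>i. i \<in> A \<Longrightarrow> polyfun (f i)) \<Longrightarrow> polyfun (\<lambda>z. \<Sum>i\<in>A. f i z)"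
  by (induction A rule: infinite_finite_induct) (auto intro: polyfun_intros)

lemma polyfun_power [polyfun_intros]: "polyfun f \<Longrightarrow> polyfun (\<lambda>z. f z ^ n)"
  by (induction n) (auto intro: polyfun_intros)

lemma poly_deg_power:
  "poly_deg k f \<Longrightarrow> poly_deg (k * int n) (\<lambda>z. f z ^ n)"
proof (induction n)
  case 0 then show ?case by (simp add: poly_deg.const)
next
  case (Suc n)
  from poly_deg_mult[OF Suc.prems Suc.IH[OF Suc.prems]] show ?case
    by (simp add: algebra_simps)
qed

lemma poly_deg_prod:
  "(\<And>i. i \<in> A \<Longrightarrow> poly_deg (k i) (f i)) \<Longrightarrow>
    poly_deg (\<Sum>i\<in>A. k i) (\<lambda>z. \<Prod>i\<in>A. f i z)"
  by (induction A rule: infinite_finite_induct) (auto intro: poly_deg.const poly_deg_mult)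

lemma poly_deg_monomial: "poly_deg (int (\<Sum>b\<in>Basis. \<alpha> b)) (monomial \<alpha>)"
  using poly_deg_prod[of Basis "\<lambda>b. 1 * int (\<alpha> b)" "\<lambda>b z. (z \<bullet> b) ^ \<alpha> b",
      OF poly_deg_power[OF poly_deg_inner_Basis]]
  unfolding monomial_def by simp

lemma polys_upto_imp_poly_deg: "p \<in> polys_upto n \<Longrightarrow> poly_deg (int n) p"
  unfolding polys_upto_def multi_indices_def
  by (auto intro!: poly_deg_sum poly_deg_cmult poly_deg_mono[OF poly_deg_monomial]
      simp del: of_nat_sum)

lemma finite_multi_indices: "finite (multi_indices n)"
  unfolding multi_indices_def
  by (rule finite_subset[of _ "Basis \<rightarrow>\<^sub>E {..n}"]) (auto intro: finite_PiE)

text \<open>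
  Multi-indices are extensional, so an arbitrary exponent function has to be restricted to the
  basis before it can index the sum; the monomial depends only on this restriction.
\<close>

lemma monomial_in_polys_upto:
  assumes "(\<Sum>b\<in>Basis. \<alpha> b) \<le> n"
  shows "monomial \<alpha> \<in> polys_upto n"
proof -
  let ?\<beta> = "restrict \<alpha> Basis"
  have le: "\<alpha> b \<le> n" if "b \<in> Basis" for b
    using member_le_sum[of b Basis \<alpha>] that assms by simp
  have \<beta>: "?\<beta> \<in> multi_indices n"
    using assms le by (auto simp: multi_indices_def)
  have "monomial \<alpha> = (\<lambda>z. \<Sum>\<gamma>\<in>multi_indices n. (if \<gamma> = ?\<beta> then 1 else 0) * monomial \<gamma> z)"
  proof
    fix z
    have "(\<Sum>\<gamma>\<in>multi_indices n. (if \<gamma> = ?\<beta> then 1 else 0) * monomial \<gamma> z)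
        = (\<Sum>\<gamma>\<in>multi_indices n. (if \<gamma> = ?\<beta> then monomial ?\<beta> z else 0))"
      by (rule sum.cong) auto
    also have "\<dots> = monomial ?\<beta> z"
      using \<beta> by (simp add: sum.delta finite_multi_indices)
    finally show "monomial \<alpha> z = (\<Sum>\<gamma>\<in>multi_indices n. (if \<gamma> = ?\<beta> then 1 else 0) * monomial \<gamma> z)"
      by (simp add: monomial_def)
  qed
  then show ?thesis unfolding polys_upto_def mem_Collect_eq
    by (rule exI[of _ "\<lambda>\<gamma>. if \<gamma> = ?\<beta> then 1 else 0"])
qed

lemma polys_upto_add:
  assumes "p \<in> polys_upto n" "q \<in> polys_upto n"
  shows "(\<lambda>z. p z + q z) \<in> polys_upto n"
proof -
  from assms obtain c d where
    "p = (\<lambda>z. \<Sum>\<alpha>\<in>multi_indices n. c \<alpha> * monomial \<alpha> z)"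
    "q = (\<lambda>z. \<Sum>\<alpha>\<in>multi_indices n. d \<alpha> * monomial \<alpha> z)" by (auto simp: polys_upto_def)
  then show ?thesis
    by (auto simp: polys_upto_def sum.distrib distrib_right intro!: exI[of _ "\<lambda>\<alpha>. c \<alpha> + d \<alpha>"])
qed

lemma polys_upto_cmult:
  assumes "p \<in> polys_upto n"
  shows "(\<lambda>z. a * p z) \<in> polys_upto n"
proof -
  from assms obtain c where
    "p = (\<lambda>z. \<Sum>\<alpha>\<in>multi_indices n. c \<alpha> * monomial \<alpha> z)" by (auto simp: polys_upto_def)
  then show ?thesis
    by (auto simp: polys_upto_def sum_distrib_left mult.assoc intro!: exI[of _ "\<lambda>\<alpha>. a * c \<alpha>"])
qed

lemma polys_upto_zero: "(\<lambda>z. 0) \<in> polys_upto n"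
  by (auto simp: polys_upto_def intro!: exI[of _ "\<lambda>_. 0"])

lemma polys_upto_sum:
  "(\<And>i. i \<in> A \<Longrightarrow> f i \<in> polys_upto n) \<Longrightarrow> (\<lambda>z. \<Sum>i\<in>A. f i z) \<in> polys_upto n"
  by (induction A rule: infinite_finite_induct) (auto intro: polys_upto_zero polys_upto_add)

lemma polys_upto_coord:
  assumes "p \<in> polys_upto n" "b \<in> Basis"
  shows "(\<lambda>z. (z \<bullet> b) * p z) \<in> polys_upto (Suc n)"
proof -
  from assms obtain c where c:
    "p = (\<lambda>z. \<Sum>\<alpha>\<in>multi_indices n. c \<alpha> * monomial \<alpha> z)" by (auto simp: polys_upto_def)
  have mono: "(z \<bullet> b) * monomial \<alpha> z = monomial (\<alpha>(b := Suc (\<alpha> b))) z" for \<alpha> and z :: 'a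
  proof -
    have "monomial (\<alpha>(b := Suc (\<alpha> b))) z
        = (z \<bullet> b) ^ Suc (\<alpha> b) * (\<Prod>i\<in>Basis - {b}. (z \<bullet> i) ^ (\<alpha>(b := Suc (\<alpha> b))) i)"
      unfolding monomial_def by (subst prod.remove[of _ b]) (use assms in auto)
    also have "(\<Prod>i\<in>Basis - {b}. (z \<bullet> i) ^ (\<alpha>(b := Suc (\<alpha> b))) i)
        = (\<Prod>i\<in>Basis - {b}. (z \<bullet> i) ^ \<alpha> i)"
      by (rule prod.cong) auto
    finally show ?thesis
      unfolding monomial_def by (subst prod.remove[of _ b]) (use assms in auto)
  qed
  have deg: "(\<Sum>i\<in>Basis. (\<alpha>(b := Suc (\<alpha> b))) i) = Suc (\<Sum>i\<in>Basis. \<alpha> i)" for \<alpha> :: "'a \<Rightarrow> nat"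
  proof -
    have "(\<Sum>i\<in>Basis - {b}. (\<alpha>(b := Suc (\<alpha> b))) i) = (\<Sum>i\<in>Basis - {b}. \<alpha> i)"
      by (rule sum.cong) auto
    then show ?thesis
      using assms(2) by (simp add: sum.remove[of _ b])
  qed
  have "(\<lambda>z. \<Sum>\<alpha>\<in>multi_indices n. c \<alpha> * monomial (\<alpha>(b := Suc (\<alpha> b))) z) \<in> polys_upto (Suc n)"
    by (intro polys_upto_sum polys_upto_cmult monomial_in_polys_upto, subst deg)
      (auto simp: multi_indices_def)
  also have "(\<lambda>z. \<Sum>\<alpha>\<in>multi_indices n. c \<alpha> * monomial (\<alpha>(b := Suc (\<alpha> b))) z)
      = (\<lambda>z. (z \<bullet> b) * p z)"
    by (simp add: c sum_distrib_left mono[symmetric] mult.left_commute)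
  finally show ?thesis .
qed

lemma polys_upto_const: "(\<lambda>z. c) \<in> polys_upto n"
proof -
  have "monomial (\<lambda>_. 0) \<in> polys_upto n" by (rule monomial_in_polys_upto) simp
  from polys_upto_cmult[OF this, of c] show ?thesis by (simp add: monomial_def)
qed

lemma poly_deg_imp_polys_upto: "poly_deg k p \<Longrightarrow> 0 \<le> k \<Longrightarrow> p \<in> polys_upto (nat k)"
proof (induction rule: poly_deg.induct)
  case (coord k f b)
  show ?case
  proof (cases "k < 0")
    case True
    then show ?thesis using poly_deg_neg[OF coord.hyps(1)] polys_upto_zero by simp
  next
    case False
    then have "nat (k + 1) = Suc (nat k)" by simp
    with False coord polys_upto_coord show ?thesis by simp
  qed
qed (auto intro: polys_upto_zero polys_upto_const polys_upto_add)

text \<open>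
  Testing against the polynomials of degree exactly \<open>m\<close>, for all \<open>m < n\<close>, is testing
  against all polynomials of lower degree, since each lies in a smallest \<open>polys_upto m\<close>. For
  \<open>n = 0\<close> the bound is \<open>-1\<close> and \<open>q\<close> is zero.
\<close>

lemma orth_polys_orthogonal:
  assumes "u \<in> orth_polys n \<Omega> W" "poly_deg (int n - 1) q"
  shows "weighted_inner \<Omega> W u q = 0"
proof (cases n)
  case 0
  then have "q = (\<lambda>z. 0)" using poly_deg_neg[OF assms(2)] by simp
  then show ?thesis by (simp add: weighted_inner_def)
next
  case (Suc k)
  then have q: "q \<in> polys_upto k" using poly_deg_imp_polys_upto[OF assms(2)] by simp
  define m where "m = (LEAST m. q \<in> polys_upto m)"
  have "q \<in> polys_upto m" "m \<le> k"
    unfolding m_def using q by (auto intro: LeastI Least_le)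
  moreover have "q \<notin> polys_upto l" if "l < m" for l
    using not_less_Least that unfolding m_def by blast
  ultimately have "poly_of_degree m q" "m < n"
    using Suc by (auto simp: poly_of_degree_def)
  then show ?thesis using assms(1) by (auto simp: orth_polys_def)
qed

lemma orth_polys_poly_deg: "u \<in> orth_polys n \<Omega> W \<Longrightarrow> poly_deg (int n) u"
  by (auto simp: orth_polys_def poly_of_degree_def intro: poly_deg.zero polys_upto_imp_poly_deg)

lemma poly_deg_has_derivative:
  "poly_deg k f \<Longrightarrow> b \<in> Basis \<Longrightarrow>
    \<exists>f'. poly_deg (k - 1) f' \<and> (\<forall>z. ((\<lambda>s. f (z + s *\<^sub>R b)) has_real_derivative f' z) (at 0))"
proof (induction rule: poly_deg.induct)
  case (zero k)
  show ?case by (rule exI[of _ "\<lambda>z. 0"]) (auto intro: poly_deg.intros)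
next
  case (const k c)
  show ?case by (rule exI[of _ "\<lambda>z. 0"]) (auto intro: poly_deg.intros)
next
  case (add k f g)
  then obtain f' g' where "poly_deg (k - 1) f'" "poly_deg (k - 1) g'"
    "\<And>z. ((\<lambda>s. f (z + s *\<^sub>R b)) has_real_derivative f' z) (at 0)"
    "\<And>z. ((\<lambda>s. g (z + s *\<^sub>R b)) has_real_derivative g' z) (at 0)" by blast
  then show ?case
    by (intro exI[of _ "\<lambda>z. f' z + g' z"]) (auto intro: poly_deg.intros DERIV_add)
next
  case (coord k f b')
  then obtain f' where f': "poly_deg (k - 1) f'"
    "\<And>z. ((\<lambda>s. f (z + s *\<^sub>R b)) has_real_derivative f' z) (at 0)" by blast
  have "poly_deg (k + 1 - 1) (\<lambda>z. (b \<bullet> b') * f z + (z \<bullet> b') * f' z)"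
    using poly_deg.coord[OF f'(1) coord.hyps(2)] coord.hyps(1)
    by (auto intro!: poly_deg.add poly_deg_cmult)
  moreover have "((\<lambda>s. ((z + s *\<^sub>R b) \<bullet> b') * f (z + s *\<^sub>R b)) has_real_derivative
      (b \<bullet> b') * f z + (z \<bullet> b') * f' z) (at 0)" for z
    by (rule derivative_eq_intros f'(2) refl | simp add: inner_add_left)+
  ultimately show ?case by blast
qed

lemma poly_deg_dir_deriv: "poly_deg k f \<Longrightarrow> b \<in> Basis \<Longrightarrow> poly_deg (k - 1) (dir_deriv b f)"
  using poly_deg_has_derivative[of k f b] unfolding dir_deriv_def[abs_def]
  by (metis (mono_tags, lifting) DERIV_imp_deriv poly_deg_cong)

lemma polyfun_dir_deriv [polyfun_intros]: "polyfun f \<Longrightarrow> b \<in> Basis \<Longrightarrow> polyfun (dir_deriv b f)"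
  unfolding polyfun_def using poly_deg_dir_deriv by blast

lemma polyfun_DERIV:
  assumes "polyfun f" "b \<in> Basis"
  shows "((\<lambda>s. f (z + s *\<^sub>R b)) has_real_derivative dir_deriv b f (z + s *\<^sub>R b)) (at s)"
proof -
  from assms poly_deg_has_derivative[of _ f b] obtain f' where f':
    "\<And>z. ((\<lambda>s. f (z + s *\<^sub>R b)) has_real_derivative f' z) (at 0)"
    by (auto simp: polyfun_def)
  then have eq: "dir_deriv b f z = f' z" for z
    unfolding dir_deriv_def by (rule DERIV_imp_deriv)
  have "((\<lambda>h. f ((z + s *\<^sub>R b) + h *\<^sub>R b)) has_real_derivative f' (z + s *\<^sub>R b)) (at 0)"
    by (rule f')
  then have "((\<lambda>h. f (z + (h + s) *\<^sub>R b)) has_real_derivative f' (z + s *\<^sub>R b)) (at 0)"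
    by (simp add: scaleR_add_left add.assoc add.commute[of s])
       (simp add: add_ac)
  from this DERIV_shift[of "\<lambda>s. f (z + s *\<^sub>R b)" "f' (z + s *\<^sub>R b)" 0 s] show ?thesis
    by (simp add: eq)
qed

lemma dir_deriv_eqI:
  assumes "\<And>z. ((\<lambda>s. f (z + s *\<^sub>R b)) has_real_derivative f' z) (at 0)"
  shows "dir_deriv b f = f'"
  using assms unfolding dir_deriv_def by (auto intro: DERIV_imp_deriv)

lemma dir_deriv_const: "dir_deriv b (\<lambda>z. c) = (\<lambda>z. 0)"
  by (rule dir_deriv_eqI) auto

lemma dir_deriv_coord: "dir_deriv b (\<lambda>z. z \<bullet> b') = (\<lambda>z. b \<bullet> b')"
  by (rule dir_deriv_eqI)
    (auto intro!: derivative_eq_intros simp: inner_add_left)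

context
  fixes f g :: "'a::euclidean_space \<Rightarrow> real" and b :: 'a
  assumes f: "polyfun f" and g: "polyfun g" and b: "b \<in> Basis"
begin

lemma dir_deriv_add: "dir_deriv b (\<lambda>z. f z + g z) = (\<lambda>z. dir_deriv b f z + dir_deriv b g z)"
  using polyfun_DERIV[OF f b, of _ 0] polyfun_DERIV[OF g b, of _ 0]
  by (intro dir_deriv_eqI) (auto intro!: derivative_eq_intros)

lemma dir_deriv_diff: "dir_deriv b (\<lambda>z. f z - g z) = (\<lambda>z. dir_deriv b f z - dir_deriv b g z)"
  using polyfun_DERIV[OF f b, of _ 0] polyfun_DERIV[OF g b, of _ 0]
  by (intro dir_deriv_eqI) (auto intro!: derivative_eq_intros)

lemma dir_deriv_mult:
  "dir_deriv b (\<lambda>z. f z * g z) = (\<lambda>z. dir_deriv b f z * g z + f z * dir_deriv b g z)"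
  using polyfun_DERIV[OF f b, of _ 0] polyfun_DERIV[OF g b, of _ 0]
  by (intro dir_deriv_eqI) (auto intro!: derivative_eq_intros)

end

lemma dir_deriv_sum:
  assumes b: "b \<in> Basis"
  shows "(\<And>i. i \<in> A \<Longrightarrow> polyfun (f i)) \<Longrightarrow>
    dir_deriv b (\<lambda>z. \<Sum>i\<in>A. f i z) = (\<lambda>z. \<Sum>i\<in>A. dir_deriv b (f i) z)"
  by (induction A rule: infinite_finite_induct)
    (auto simp: dir_deriv_const dir_deriv_add polyfun_sum b)

lemma dir_deriv_commute:
  assumes a: "a \<in> Basis" and b: "b \<in> Basis"
  shows "poly_deg k f \<Longrightarrow> dir_deriv a (dir_deriv b f) = dir_deriv b (dir_deriv a f)"
proof (induction rule: poly_deg.induct)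
  case (add k f g)
  then have "polyfun f" "polyfun g" by (auto intro: polyfunI)
  then show ?case
    using add by (simp add: dir_deriv_add polyfun_dir_deriv a b)
next
  case (coord k f c)
  then have f: "polyfun f" and c: "polyfun (\<lambda>z. z \<bullet> c)"
    by (auto intro: polyfunI poly_deg_inner_Basis)
  show ?case
    by (simp add: dir_deriv_mult dir_deriv_add dir_deriv_coord dir_deriv_const polyfun_dir_deriv
        polyfun_mult polyfun_const f c a b coord.IH fun_eq_iff)
qed (simp_all add: dir_deriv_const)

text \<open>
  Euler's identity for homogeneous functions: \<open>\<Sum>\<^sub>b z\<^sub>b \<partial>\<^sub>b\<close> multiplies the homogeneous part
  of degree \<open>k\<close> by \<open>k\<close>, so the part of top degree cancels in the difference. In the
  induction, a further factor \<open>z\<^sub>c\<close> contributes exactly one more copy of \<open>z\<^sub>c f\<close>.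
\<close>

lemma poly_deg_Euler:
  "poly_deg k f \<Longrightarrow>
    poly_deg (k - 1) (\<lambda>z. (\<Sum>b\<in>Basis. (z \<bullet> b) * dir_deriv b f z) - of_int k * f z)"
proof (induction rule: poly_deg.induct)
  case (zero k)
  then show ?case by (simp add: dir_deriv_const poly_deg.zero)
next
  case (const k c)
  then show ?case by (cases "k = 0") (auto simp: dir_deriv_const intro: poly_deg.intros)
next
  case (add k f g)
  then have "polyfun f" "polyfun g" by (auto intro: polyfunI)
  with poly_deg.add[OF add.IH] show ?case
    by (simp add: dir_deriv_add algebra_simps sum.distrib)
next
  case (coord k f c)
  then have f: "polyfun f" and c: "polyfun (\<lambda>z. z \<bullet> c)"
    by (auto intro: polyfunI poly_deg_inner_Basis)
  have "(\<Sum>b\<in>Basis. (z \<bullet> b) * dir_deriv b (\<lambda>z. (z \<bullet> c) * f z) z) - of_int (k + 1) * ((z \<bullet> c) * f z)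
      = (z \<bullet> c) * ((\<Sum>b\<in>Basis. (z \<bullet> b) * dir_deriv b f z) - of_int k * f z)" for z
  proof -
    have "(\<Sum>b\<in>Basis. (z \<bullet> b) * dir_deriv b (\<lambda>z. (z \<bullet> c) * f z) z)
        = (\<Sum>b\<in>Basis. (z \<bullet> b) * ((b \<bullet> c) * f z + (z \<bullet> c) * dir_deriv b f z))"
      by (simp add: dir_deriv_mult f c dir_deriv_coord)
    also have "\<dots> = (\<Sum>b\<in>Basis. (z \<bullet> b) * (b \<bullet> c)) * f z
        + (z \<bullet> c) * (\<Sum>b\<in>Basis. (z \<bullet> b) * dir_deriv b f z)"
      by (simp add: algebra_simps sum.distrib sum_distrib_left sum_distrib_right)
    also have "(\<Sum>b\<in>Basis. (z \<bullet> b) * (b \<bullet> c)) = z \<bullet> c"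
      using euclidean_inner[of z c] by (simp add: inner_commute)
    finally show ?thesis by (simp add: algebra_simps)
  qed
  with poly_deg.coord[OF coord.IH coord.hyps(2)] show ?case by simp
qed

lemma polyfun_continuous: "polyfun f \<Longrightarrow> continuous_on S f"
proof -
  have "poly_deg k f \<Longrightarrow> continuous_on S f" for k
    by (induction rule: poly_deg.induct) (auto intro!: continuous_intros)
  then show "polyfun f \<Longrightarrow> continuous_on S f" by (auto simp: polyfun_def)
qed

lemma polyfun_measurable: "polyfun f \<Longrightarrow> f \<in> borel_measurable borel"
  by (intro borel_measurable_continuous_onI polyfun_continuous)

lemma polyfun_on_line: "polyfun f \<Longrightarrow> \<exists>p. \<forall>s. f (a + s *\<^sub>R v) = poly p s"
proof -
  have "poly_deg k f \<Longrightarrow> \<exists>p. \<forall>s. f (a + s *\<^sub>R v) = poly p s" for k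
  proof (induction rule: poly_deg.induct)
    case (zero k) show ?case by (rule exI[of _ 0]) simp
  next
    case (const k c) show ?case by (rule exI[of _ "[:c:]"]) simp
  next
    case (add k f g)
    then obtain p q where "\<forall>s. f (a + s *\<^sub>R v) = poly p s" "\<forall>s. g (a + s *\<^sub>R v) = poly q s" by blast
    then show ?case by (intro exI[of _ "p + q"]) simp
  next
    case (coord k f b)
    then obtain p where "\<forall>s. f (a + s *\<^sub>R v) = poly p s" by blast
    then show ?case
      by (intro exI[of _ "[:a \<bullet> b, v \<bullet> b:] * p"]) (simp add: inner_add_left algebra_simps)
  qed
  then show "polyfun f \<Longrightarrow> ?thesis" by (auto simp: polyfun_def)
qed

text \<open>
  On the line from \<open>a\<close> to an arbitrary point the function is a polynomial in one variable
  with infinitely many zeros near \<open>a\<close>.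
\<close>

lemma polyfun_zero_on_open:
  assumes f: "polyfun f" and U: "open U" "a \<in> U" and 0: "\<And>z. z \<in> U \<Longrightarrow> f z = 0"
  shows "f = (\<lambda>z. 0)"
proof
  fix w
  obtain p where p: "\<And>s. f (a + s *\<^sub>R (w - a)) = poly p s"
    using polyfun_on_line[OF f, of a "w - a"] by blast
  have "((\<lambda>s. a + s *\<^sub>R (w - a)) \<longlongrightarrow> a + 0 *\<^sub>R (w - a)) (at_right (0::real))"
    by (intro tendsto_intros)
  then have "eventually (\<lambda>s. a + s *\<^sub>R (w - a) \<in> U) (at_right (0::real))"
    using U by (auto dest: topological_tendstoD)
  then obtain e :: real where e: "e > 0" "\<And>s. 0 < s \<Longrightarrow> s < e \<Longrightarrow> a + s *\<^sub>R (w - a) \<in> U"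
    by (auto simp: eventually_at_right_field)
  have "{0<..<e} \<subseteq> {s. poly p s = 0}"
    using e(2) 0 by (auto simp: p[symmetric])
  then have "p = 0"
    using poly_roots_finite[of p] infinite_Ioo[OF e(1)] finite_subset by blast
  with p[of 1] show "f w = 0" by simp
qed

section \<open>The partial derivatives in the two groups of variables\<close>

definition slack :: "(real ^ 'd1) \<times> (real ^ 'd2) \<Rightarrow> real" where
  "slack z = 1 - ysum (snd z)"

lemma x_axis_Basis: "(axis i 1, 0) \<in> (Basis :: ((real ^ 'd1) \<times> (real ^ 'd2)) set)"
  by (auto simp: Basis_prod_def axis_in_Basis_iff)

lemma y_axis_Basis: "(0, axis j 1) \<in> (Basis :: ((real ^ 'd1) \<times> (real ^ 'd2)) set)"
  by (auto simp: Basis_prod_def axis_in_Basis_iff)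

lemma fst_nth_eq_inner: "fst z $ i = z \<bullet> (axis i 1, 0)"
  by (simp add: inner_prod_def inner_axis)

lemma snd_nth_eq_inner: "snd z $ j = z \<bullet> (0, axis j 1)"
  by (simp add: inner_prod_def inner_axis)

lemma poly_deg_fst_nth: "poly_deg 1 (\<lambda>z :: (real ^ 'd1) \<times> (real ^ 'd2). fst z $ i)"
  unfolding fst_nth_eq_inner by (rule poly_deg_inner_Basis[OF x_axis_Basis])

lemma poly_deg_snd_nth: "poly_deg 1 (\<lambda>z :: (real ^ 'd1) \<times> (real ^ 'd2). snd z $ j)"
  unfolding snd_nth_eq_inner by (rule poly_deg_inner_Basis[OF y_axis_Basis])

lemma poly_deg_slack: "poly_deg 1 (slack :: (real ^ 'd1) \<times> (real ^ 'd2) \<Rightarrow> real)"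
  unfolding slack_def[abs_def] ysum_def
  by (intro poly_deg_diff poly_deg_sum poly_deg_snd_nth poly_deg.const) simp

lemmas polyfun_fst_nth [polyfun_intros] = polyfunI[OF poly_deg_fst_nth]
lemmas polyfun_snd_nth [polyfun_intros] = polyfunI[OF poly_deg_snd_nth]
lemmas polyfun_slack [polyfun_intros] = polyfunI[OF poly_deg_slack]

lemma polyfun_dx [polyfun_intros]: "polyfun f \<Longrightarrow> polyfun (dx i f)"
  unfolding dx_def by (rule polyfun_dir_deriv[OF _ x_axis_Basis])

lemma polyfun_dy [polyfun_intros]: "polyfun f \<Longrightarrow> polyfun (dy j f)"
  unfolding dy_def by (rule polyfun_dir_deriv[OF _ y_axis_Basis])

lemma polyfun_laplace_x [polyfun_intros]: "polyfun f \<Longrightarrow> polyfun (laplace_x f)"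
  unfolding laplace_x_def[abs_def] by (intro polyfun_intros)

lemma polyfun_euler_x [polyfun_intros]: "polyfun f \<Longrightarrow> polyfun (euler_x f)"
  unfolding euler_x_def[abs_def] by (intro polyfun_intros)

lemma polyfun_euler_y [polyfun_intros]: "polyfun f \<Longrightarrow> polyfun (euler_y f)"
  unfolding euler_y_def[abs_def] by (intro polyfun_intros)

lemma polyfun_euler_xy [polyfun_intros]: "polyfun f \<Longrightarrow> polyfun (euler_xy f)"
  unfolding euler_xy_def[abs_def] by (intro polyfun_intros)

lemma dx_fst_nth: "dx i (\<lambda>z. fst z $ k) = (\<lambda>z. if i = k then 1 else 0)"
  unfolding dx_def fst_nth_eq_inner dir_deriv_coord by (auto simp: inner_prod_def inner_axis_axis)

lemma dx_snd_nth: "dx i (\<lambda>z. snd z $ k) = (\<lambda>z. 0)"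
  unfolding dx_def snd_nth_eq_inner dir_deriv_coord by (auto simp: inner_prod_def inner_axis)

lemma dx_slack: "dx i slack = (\<lambda>z. 0)"
  unfolding slack_def[abs_def] dx_def dir_deriv_def by (auto intro!: DERIV_imp_deriv)

lemma dx_const: "dx i (\<lambda>z. c) = (\<lambda>z. 0)"
  unfolding dx_def by (rule dir_deriv_const)

lemma dy_const: "dy j (\<lambda>z. c) = (\<lambda>z. 0)"
  unfolding dy_def by (rule dir_deriv_const)

lemmas dx_add = dir_deriv_add[OF _ _ x_axis_Basis, folded dx_def]
lemmas dx_diff = dir_deriv_diff[OF _ _ x_axis_Basis, folded dx_def]
lemmas dx_mult = dir_deriv_mult[OF _ _ x_axis_Basis, folded dx_def]
lemmas dx_sum = dir_deriv_sum[OF x_axis_Basis, folded dx_def]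
lemmas dy_add = dir_deriv_add[OF _ _ y_axis_Basis, folded dy_def]
lemmas dy_diff = dir_deriv_diff[OF _ _ y_axis_Basis, folded dy_def]
lemmas dy_mult = dir_deriv_mult[OF _ _ y_axis_Basis, folded dy_def]

lemma dx_dx_commute: "polyfun f \<Longrightarrow> dx i (dx k f) = dx k (dx i f)"
  unfolding dx_def polyfun_def by (auto intro: dir_deriv_commute[OF x_axis_Basis x_axis_Basis])

lemma dx_slack_power_mult:
  assumes "polyfun f"
  shows "dx i (\<lambda>z. slack z ^ m * f z) = (\<lambda>z. slack z ^ m * dx i f z)"
proof (induction m)
  case (Suc m)
  have "dx i (\<lambda>z. slack z * (slack z ^ m * f z)) = (\<lambda>z. slack z * (slack z ^ m * dx i f z))"
    by (subst dx_mult) (use assms in \<open>auto intro!: polyfun_intros simp: dx_slack Suc\<close>)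
  then show ?case by (simp add: mult.assoc)
qed simp

lemma euler_x_add:
  "polyfun f \<Longrightarrow> polyfun g \<Longrightarrow> euler_x (\<lambda>z. f z + g z) = (\<lambda>z. euler_x f z + euler_x g z)"
  by (simp add: euler_x_def[abs_def] dx_add algebra_simps sum.distrib)

lemma euler_x_diff:
  "polyfun f \<Longrightarrow> polyfun g \<Longrightarrow> euler_x (\<lambda>z. f z - g z) = (\<lambda>z. euler_x f z - euler_x g z)"
  by (simp add: euler_x_def[abs_def] dx_diff algebra_simps sum_subtractf)

lemma euler_x_cmult: "polyfun f \<Longrightarrow> euler_x (\<lambda>z. c * f z) = (\<lambda>z. c * euler_x f z)"
  by (simp add: euler_x_def[abs_def] dx_mult polyfun_const dx_const algebra_simps sum_distrib_left)

lemma euler_x_slack_power_mult: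
  "polyfun f \<Longrightarrow> euler_x (\<lambda>z. slack z ^ m * f z) = (\<lambda>z. slack z ^ m * euler_x f z)"
  by (simp add: euler_x_def[abs_def] dx_slack_power_mult sum_distrib_left mult.left_commute)

lemma euler_x_snd_mult:
  "polyfun f \<Longrightarrow> euler_x (\<lambda>z. snd z $ j * f z) = (\<lambda>z. snd z $ j * euler_x f z)"
  by (simp add: euler_x_def[abs_def] dx_mult polyfun_snd_nth dx_snd_nth algebra_simps sum_distrib_left)

lemma euler_x_sum:
  "(\<And>i. i \<in> A \<Longrightarrow> polyfun (f i)) \<Longrightarrow> euler_x (\<lambda>z. \<Sum>i\<in>A. f i z) = (\<lambda>z. \<Sum>i\<in>A. euler_x (f i) z)"
  by (induction A rule: infinite_finite_induct)
    (auto simp: euler_x_add polyfun_sum, auto simp: euler_x_def dx_const)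

lemma dx_euler_x:
  assumes "polyfun f"
  shows "dx i (euler_x f) = (\<lambda>z. dx i f z + euler_x (dx i f) z)"
proof
  fix z
  have "dx i (euler_x f) z = (\<Sum>k\<in>UNIV. (if i = k then 1 else 0) * dx k f z + fst z $ k * dx i (dx k f) z)"
    unfolding euler_x_def[abs_def]
    by (simp add: dx_sum dx_mult polyfun_mult polyfun_fst_nth polyfun_dx assms dx_fst_nth)
  also have "\<dots> = (\<Sum>k\<in>UNIV. if i = k then dx k f z else 0) + euler_x (dx i f) z"
    by (simp add: sum.distrib euler_x_def dx_dx_commute[OF assms, of i] if_distrib[of "\<lambda>c. c * _"] cong: if_cong)
  finally show "dx i (euler_x f) z = dx i f z + euler_x (dx i f) z" by simp
qed

lemma laplace_x_diff:
  "polyfun f \<Longrightarrow> polyfun g \<Longrightarrow> laplace_x (\<lambda>z. f z - g z) = (\<lambda>z. laplace_x f z - laplace_x g z)"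
  by (simp add: laplace_x_def[abs_def] dx_diff polyfun_dx sum_subtractf)

lemma laplace_x_cmult: "polyfun f \<Longrightarrow> laplace_x (\<lambda>z. c * f z) = (\<lambda>z. c * laplace_x f z)"
  by (simp add: laplace_x_def[abs_def] dx_mult polyfun_const polyfun_dx dx_const sum_distrib_left)

lemma laplace_x_slack_power_mult:
  "polyfun f \<Longrightarrow> laplace_x (\<lambda>z. slack z ^ m * f z) = (\<lambda>z. slack z ^ m * laplace_x f z)"
  by (simp add: laplace_x_def[abs_def] dx_slack_power_mult polyfun_dx sum_distrib_left)

text \<open>
  The commutator of the Laplacian and the Euler operator in \<open>x\<close> is twice the Laplacian. This
  second-order term is what makes the square of \<open>hermite_op\<close> reproduce the coefficient
  \<open>1\<close> in front of \<open>(1 - |y|) \<Delta>\<^sub>x\<close>.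
\<close>

lemma laplace_x_euler_x:
  assumes "polyfun f"
  shows "laplace_x (euler_x f) = (\<lambda>z. 2 * laplace_x f z + euler_x (laplace_x f) z)"
proof
  fix z
  have "laplace_x (euler_x f) z = (\<Sum>i\<in>UNIV. 2 * dx i (dx i f) z + euler_x (dx i (dx i f)) z)"
    unfolding laplace_x_def
    by (simp add: dx_euler_x assms dx_add polyfun_dx polyfun_euler_x add.assoc[symmetric])
  also have "\<dots> = 2 * laplace_x f z + (\<Sum>i\<in>UNIV. euler_x (dx i (dx i f)) z)"
    by (simp add: sum.distrib laplace_x_def sum_distrib_left)
  also have "(\<Sum>i\<in>UNIV. euler_x (dx i (dx i f)) z) = euler_x (laplace_x f) z"
    by (simp add: euler_x_sum polyfun_dx assms laplace_x_def[abs_def])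
  finally show "laplace_x (euler_x f) z = 2 * laplace_x f z + euler_x (laplace_x f) z" .
qed

lemma euler_x_euler_y:
  assumes "polyfun f"
  shows "euler_x (euler_y f) z = (\<Sum>j\<in>UNIV. snd z $ j * euler_x (dy j f) z)"
  unfolding euler_y_def[abs_def]
  by (simp add: euler_x_sum polyfun_mult polyfun_snd_nth polyfun_dy assms euler_x_snd_mult)

section \<open>Decomposition of the operator\<close>

text \<open>
  In the variable \<open>\<xi> = x / (1 - |y|)\<close> this is the Hermite operator
  \<open>\<Delta>\<^sub>\<xi> / 2 - \<langle>\<xi>, \<nabla>\<^sub>\<xi>\<rangle>\<close>.
\<close>

definition hermite_op :: "((real ^ 'd1) \<times> (real ^ 'd2) \<Rightarrow> real) \<Rightarrow> (real ^ 'd1) \<times> (real ^ 'd2) \<Rightarrow> real" where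
  "hermite_op f z = 1/2 * (slack z ^ 2 * laplace_x f z) - euler_x f z"

text \<open>
  This is \<open>1 - |y|\<close> times the derivative in \<open>y\<^sub>j\<close> taken at fixed
  \<open>\<xi> = x / (1 - |y|)\<close>. The factor removes the denominator, so that
  polynomials are mapped to polynomials.
\<close>

definition scaled_dy ::
  "'d2::finite \<Rightarrow> ((real ^ 'd1) \<times> (real ^ 'd2) \<Rightarrow> real) \<Rightarrow> (real ^ 'd1) \<times> (real ^ 'd2) \<Rightarrow> real" where
  "scaled_dy j f z = slack z * dy j f z - euler_x f z"

text \<open>
  Write \<open>D\<^sub>j\<close> for the derivative in \<open>y\<^sub>j\<close> at fixed \<open>\<xi>\<close>. Then
  this is \<open>D\<^sub>j f - \<Sum>\<^sub>k y\<^sub>k D\<^sub>k f\<close>: each \<open>D\<^sub>k\<close> carries a term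
  \<open>- \<langle>x, \<nabla>\<^sub>x\<rangle> / (1 - |y|)\<close>, and these combine to
  \<open>- \<langle>x, \<nabla>\<^sub>x\<rangle>\<close> because \<open>\<Sum>\<^sub>k y\<^sub>k - 1 = - (1 - |y|)\<close>.
  Hence no denominator occurs.
\<close>

definition flux ::
  "'d2::finite \<Rightarrow> ((real ^ 'd1) \<times> (real ^ 'd2) \<Rightarrow> real) \<Rightarrow> (real ^ 'd1) \<times> (real ^ 'd2) \<Rightarrow> real" where
  "flux j f z = dy j f z - euler_xy f z"

text \<open>
  This is \<open>1 - |y|\<close> times the Jacobi operator of the simplex at fixed \<open>\<xi>\<close>, with
  \<open>\<kappa> $ None + d\<^sub>1\<close> as the exponent of \<open>1 - |y|\<close>; the shift by \<open>d\<^sub>1\<close> is the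
  Jacobian of \<open>x \<mapsto> \<xi>\<close>. It is written as a weighted divergence of the vector field
  \<open>y\<^sub>j * flux j f\<close>, the form in which integration by parts applies.
\<close>

definition jacobi_op ::
  "real ^ ('d2::finite option) \<Rightarrow> ((real ^ 'd1) \<times> (real ^ 'd2) \<Rightarrow> real)
     \<Rightarrow> (real ^ 'd1) \<times> (real ^ 'd2) \<Rightarrow> real" where
  "jacobi_op \<kappa> f z = (\<Sum>j\<in>UNIV. snd z $ j * scaled_dy j (flux j f) z
     + ((\<kappa> $ Some j + 1) * slack z - (\<kappa> $ None + real CARD('d1)) * snd z $ j) * flux j f z)"

lemma polyfun_hermite_op [polyfun_intros]: "polyfun f \<Longrightarrow> polyfun (hermite_op f)"
  unfolding hermite_op_def[abs_def] by (intro polyfun_intros)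

lemma polyfun_scaled_dy [polyfun_intros]: "polyfun f \<Longrightarrow> polyfun (scaled_dy j f)"
  unfolding scaled_dy_def[abs_def] by (intro polyfun_intros)

lemma polyfun_flux [polyfun_intros]: "polyfun f \<Longrightarrow> polyfun (flux j f)"
  unfolding flux_def[abs_def] by (intro polyfun_intros)

lemma polyfun_jacobi_op [polyfun_intros]: "polyfun f \<Longrightarrow> polyfun (jacobi_op \<kappa> f)"
  unfolding jacobi_op_def[abs_def] by (intro polyfun_intros)

lemma hermite_op_hermite_op:
  assumes u: "polyfun u"
  shows "hermite_op (hermite_op u) z = 1/4 * (slack z ^ 4 * laplace_x (laplace_x u) z)
    - slack z ^ 2 * euler_x (laplace_x u) z - slack z ^ 2 * laplace_x u z + euler_x (euler_x u) z"
proof -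
  have eq: "hermite_op u = (\<lambda>z. 1/2 * (slack z ^ 2 * laplace_x u z) - euler_x u z)"
    by (simp add: hermite_op_def[abs_def])
  have 1: "laplace_x (hermite_op u) z = 1/2 * (slack z ^ 2 * laplace_x (laplace_x u) z)
      - (2 * laplace_x u z + euler_x (laplace_x u) z)"
    unfolding eq
    by (simp only: laplace_x_diff laplace_x_cmult laplace_x_slack_power_mult laplace_x_euler_x u
        polyfun_intros)
  have 2: "euler_x (hermite_op u) z = 1/2 * (slack z ^ 2 * euler_x (laplace_x u) z) - euler_x (euler_x u) z"
    unfolding eq
    by (simp only: euler_x_diff euler_x_cmult euler_x_slack_power_mult u polyfun_intros)
  show ?thesis
    unfolding hermite_op_def[of "hermite_op u"] 1 2 by (simp add: algebra_simps power2_eq_square power4_eq_xxxx)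
qed

lemma sum_y: "(\<Sum>j\<in>UNIV. snd z $ j) = 1 - slack z"
  by (simp add: slack_def ysum_def)

lemma kappa_sum_option:
  "kappa_sum (\<kappa> :: real ^ ('d2::finite option)) = \<kappa> $ None + (\<Sum>j\<in>UNIV. \<kappa> $ Some j)"
  by (simp add: kappa_sum_def UNIV_option_conv sum.reindex)

text \<open>
  With \<open>t = 1 - |y|\<close>, \<open>L\<close> the Hermite operator, \<open>J\<close> the Jacobi operator
  at fixed \<open>\<xi>\<close> and \<open>c = \<kappa> $ None + d\<^sub>1\<close>, the operator of the theorem is
  \<open>J - (L\<^sup>2 - c L) / t\<close>. The fourth-order part is \<open>- L\<^sup>2 / t\<close>; the term
  \<open>\<langle>x, \<nabla>\<^sub>x\<rangle>\<^sup>2 / t\<close> contained in it cancels against the one produced by the chain rule in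
  \<open>J\<close>. Multiplying by \<open>t\<close> keeps everything polynomial.
\<close>

lemma slack_rtri_op:
  fixes u :: "(real ^ 'd1) \<times> (real ^ 'd2) \<Rightarrow> real"
  assumes u: "polyfun u"
  shows "slack z * rtri_op \<kappa> u z = jacobi_op \<kappa> u z - hermite_op (hermite_op u) z
    + (\<kappa> $ None + real CARD('d1)) * hermite_op u z"
proof -
  define c where "c = \<kappa> $ None + real CARD('d1)"
  define K where "K = (\<Sum>j\<in>UNIV. \<kappa> $ Some j + 1)"
  have K: "K = (\<Sum>j\<in>UNIV. \<kappa> $ Some j) + real CARD('d2)"
    by (simp add: K_def sum.distrib)
  have flux: "scaled_dy j (flux j u) z = slack z * (dy j (dy j u) z - dy j (euler_xy u) z)
      - (euler_x (dy j u) z - euler_x (euler_xy u) z)" for j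
    unfolding scaled_dy_def flux_def[abs_def]
    by (simp add: dy_diff euler_x_diff polyfun_dy polyfun_euler_xy u)
  have "jacobi_op \<kappa> u z = (\<Sum>j\<in>UNIV. slack z * (snd z $ j * dy j (dy j u) z)
      - slack z * (snd z $ j * dy j (euler_xy u) z) - snd z $ j * euler_x (dy j u) z
      + snd z $ j * euler_x (euler_xy u) z
      + slack z * ((\<kappa> $ Some j + 1) * dy j u z) - c * (snd z $ j * dy j u z)
      - (\<kappa> $ Some j + 1) * (slack z * euler_xy u z) + snd z $ j * (c * euler_xy u z))"
    unfolding jacobi_op_def flux flux_def[of _ u] c_def[symmetric]
    by (rule sum.cong[OF refl]) (simp add: algebra_simps)
  also have "\<dots> = slack z * (\<Sum>j\<in>UNIV. snd z $ j * dy j (dy j u) z) - slack z * euler_y (euler_xy u) z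
      - euler_x (euler_y u) z + (1 - slack z) * euler_x (euler_xy u) z
      + slack z * (\<Sum>j\<in>UNIV. (\<kappa> $ Some j + 1) * dy j u z) - c * euler_y u z
      - K * (slack z * euler_xy u z) + (1 - slack z) * (c * euler_xy u z)"
    unfolding sum.distrib sum_subtractf sum_distrib_left[symmetric] sum_distrib_right[symmetric]
      sum_y euler_y_def[symmetric] euler_x_euler_y[OF u, symmetric] by (simp add: K)
  finally have jac: "jacobi_op \<kappa> u z = \<dots>" .
  have EE: "euler_xy (euler_xy u) z = euler_x (euler_xy u) z + euler_y (euler_xy u) z"
    by (simp add: euler_xy_def)
  have NE: "euler_x (euler_xy u) z = euler_x (euler_x u) z + euler_x (euler_y u) z"
    unfolding euler_xy_def[abs_def] by (simp add: euler_x_add polyfun_euler_x polyfun_euler_y u)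
  have E: "euler_xy u z = euler_x u z + euler_y u z" by (simp add: euler_xy_def)
  have D: "rtri_op \<kappa> u z = - (1/4) * slack z ^ 3 * laplace_x (laplace_x u) z
     + slack z * euler_x (laplace_x u) z - (euler_x (euler_xy u) z + euler_y (euler_xy u) z)
     + (1 + 1/2 * c) * slack z * laplace_x u z
     + ((\<Sum>i\<in>UNIV. snd z $ i * dy i (dy i u) z) + (\<Sum>i\<in>UNIV. (\<kappa> $ Some i + 1) * dy i u z))
     - (c + K) * euler_xy u z"
  proof -
    have "kappa_sum \<kappa> + real CARD('d1) + real CARD('d2) = c + K"
      by (simp add: c_def K kappa_sum_option)
    then show ?thesis
      by (simp only: rtri_op_def split_beta prod.collapse fst_conv snd_conv EE[symmetric] sum.distrib)
        (simp add: slack_def c_def)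
  qed
  show ?thesis
    unfolding D jac hermite_op_hermite_op[OF u] c_def[symmetric] hermite_op_def[of u] NE E
    by (simp add: algebra_simps power2_eq_square power3_eq_cube power4_eq_xxxx)
qed

lemma sum_Basis_xy:
  fixes f :: "(real ^ 'd1) \<times> (real ^ 'd2) \<Rightarrow> real"
  shows "(\<Sum>b\<in>Basis. f b) = (\<Sum>i\<in>UNIV. f (axis i 1, 0)) + (\<Sum>j\<in>UNIV. f (0, axis j 1))"
proof -
  have vec: "(Basis :: (real ^ 'd) set) = range (\<lambda>i. axis i 1)"
    by (auto simp: Basis_vec_def)
  have inj: "inj (\<lambda>i. (axis i 1 :: real ^ 'd))" by (auto simp: inj_def axis_eq_axis)
  have "(\<Sum>b\<in>Basis. f b) = (\<Sum>b\<in>(\<lambda>u. (u, 0)) ` Basis. f b) + (\<Sum>b\<in>(\<lambda>v. (0, v)) ` Basis. f b)"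
    unfolding Basis_prod_def by (rule sum.union_disjoint) (auto simp: nonzero_Basis)
  then show ?thesis
    by (simp add: sum.reindex inj_on_def vec axis_eq_axis o_def)
qed

lemma poly_deg_euler_xy:
  assumes "poly_deg k f"
  shows "poly_deg (k - 1) (\<lambda>z. euler_xy f z - of_int k * f z)"
  using poly_deg_Euler[OF assms]
  by (simp add: sum_Basis_xy euler_xy_def euler_x_def euler_y_def dx_def dy_def
      fst_nth_eq_inner[symmetric] snd_nth_eq_inner[symmetric])

lemma poly_deg_dx: "poly_deg k f \<Longrightarrow> poly_deg (k - 1) (dx i f)"
  unfolding dx_def by (rule poly_deg_dir_deriv[OF _ x_axis_Basis])

lemma poly_deg_dy: "poly_deg k f \<Longrightarrow> poly_deg (k - 1) (dy j f)"
  unfolding dy_def by (rule poly_deg_dir_deriv[OF _ y_axis_Basis])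

lemma poly_deg_laplace_x: "poly_deg k f \<Longrightarrow> poly_deg (k - 2) (laplace_x f)"
  unfolding laplace_x_def[abs_def]
  by (rule poly_deg_sum) (use poly_deg_dx[OF poly_deg_dx, of k f] in simp)

lemma poly_deg_euler_x: "poly_deg k f \<Longrightarrow> poly_deg k (euler_x f)"
  unfolding euler_x_def[abs_def]
  by (rule poly_deg_sum) (use poly_deg_mult[OF poly_deg_fst_nth poly_deg_dx, of k f] in simp)

text \<open>
  All terms except the square and the multiple of the Euler operator \<open>E\<close> lower the degree by
  at least one: coefficients of degree at most three meet at least one more derivative than their
  degree. On top degree \<open>E\<close> is multiplication by \<open>k\<close>, which leaves the eigenvalue.
\<close>

lemma rtri_op_leading_part:
  fixes u :: "(real ^ 'd1) \<times> (real ^ 'd2) \<Rightarrow> real"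
  assumes u: "poly_deg k u"
  shows "poly_deg (k - 1) (\<lambda>z. rtri_op \<kappa> u z
    + of_int k * (of_int k + kappa_sum \<kappa> + real CARD('d1) + real CARD('d2)) * u z)"
proof -
  define s where "s = kappa_sum \<kappa> + real CARD('d1) + real CARD('d2)"
  define r where "r = (\<lambda>z. euler_xy u z - of_int k * u z)"
  have r: "poly_deg (k - 1) r"
    unfolding r_def by (rule poly_deg_euler_xy[OF u])
  have Er: "poly_deg (k - 1) (euler_xy r)"
    using poly_deg.add[OF poly_deg_mono[OF poly_deg_euler_xy[OF r]]
        poly_deg_cmult[OF r, of "of_int (k - 1)"]] by simp
  have u': "polyfun u" "polyfun r" using u r by (auto intro: polyfunI)
  have lin: "euler_xy (\<lambda>z. f z + c * g z) z = euler_xy f z + c * euler_xy g z"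
    if "polyfun f" "polyfun g" for f g c and z :: "(real ^ 'd1) \<times> (real ^ 'd2)"
    using that by (simp add: euler_xy_def euler_x_def euler_y_def dx_add dx_mult dx_const dy_add
        dy_mult dy_const polyfun_const polyfun_mult algebra_simps sum.distrib sum_distrib_left)
  have EE: "euler_xy (euler_xy u) z = euler_xy r z + of_int k * r z + of_int k * of_int k * u z" for z
  proof -
    have "euler_xy u = (\<lambda>z. r z + of_int k * u z)" by (simp add: r_def)
    then have "euler_xy (euler_xy u) z = euler_xy r z + of_int k * euler_xy u z"
      using u' lin by simp
    then show ?thesis by (simp add: r_def algebra_simps)
  qed
  have t3: "poly_deg 3 (\<lambda>z :: (real ^ 'd1) \<times> (real ^ 'd2). slack z ^ 3)"
    using poly_deg_power[OF poly_deg_slack, of 3] by simp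
  \<comment> \<open>The lower-order contributions, one for each group of terms of the operator.\<close>
  have A1: "poly_deg (k - 1) (\<lambda>z. - (1/4) * (slack z ^ 3 * laplace_x (laplace_x u) z))"
    using poly_deg_mult[OF t3 poly_deg_laplace_x[OF poly_deg_laplace_x[OF u]]]
    by (intro poly_deg_cmult) simp
  have A2: "poly_deg (k - 1) (\<lambda>z. slack z * euler_x (laplace_x u) z)"
    using poly_deg_mult[OF poly_deg_slack poly_deg_euler_x[OF poly_deg_laplace_x[OF u]]] by simp
  have A3: "poly_deg (k - 1) (\<lambda>z. (1 + (1/2) * (\<kappa> $ None + real CARD('d1))) * (slack z * laplace_x u z))"
    using poly_deg_mult[OF poly_deg_slack poly_deg_laplace_x[OF u]] by (intro poly_deg_cmult) simp
  have A4: "poly_deg (k - 1) (\<lambda>z. \<Sum>i\<in>UNIV. snd z $ i * dy i (dy i u) z + (\<kappa> $ Some i + 1) * dy i u z)"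
  proof (intro poly_deg_sum poly_deg.add poly_deg_cmult poly_deg_dy u)
    show "poly_deg (k - 1) (\<lambda>z. snd z $ i * dy i (dy i u) z)" for i
      using poly_deg_mult[OF poly_deg_snd_nth poly_deg_dy[OF poly_deg_dy[OF u]]] by simp
  qed
  have A5: "poly_deg (k - 1) (\<lambda>z. euler_xy r z + (of_int k + s) * r z)"
    by (intro poly_deg.add Er poly_deg_cmult r)
  show ?thesis
  proof (rule poly_deg_cong[OF poly_deg_diff[OF poly_deg.add[OF poly_deg.add[OF poly_deg.add[OF A1 A2] A3] A4] A5]],
      goal_cases)
    case (1 z)
    have D: "rtri_op \<kappa> u z = - (1/4) * (slack z ^ 3 * laplace_x (laplace_x u) z)
      + slack z * euler_x (laplace_x u) z - euler_xy (euler_xy u) z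
      + (1 + (1/2) * (\<kappa> $ None + real CARD('d1))) * (slack z * laplace_x u z)
      + (\<Sum>i\<in>UNIV. snd z $ i * dy i (dy i u) z + (\<kappa> $ Some i + 1) * dy i u z)
      - s * (r z + of_int k * u z)"
      by (simp add: rtri_op_def split_beta slack_def s_def r_def)
    show ?case unfolding D EE s_def[symmetric] add.assoc[of _ "kappa_sum \<kappa>"]
      using s_def by (simp add: algebra_simps)
  qed
qed

section \<open>Symmetry from two integration-by-parts rules\<close>

text \<open>
  Both sides are \<open>1 - |y|\<close> times the Dirichlet form
  \<open>\<Sum>\<^sub>j y\<^sub>j D\<^sub>j u D\<^sub>j v - (\<Sum>\<^sub>j y\<^sub>j D\<^sub>j u) (\<Sum>\<^sub>j y\<^sub>j D\<^sub>j v)\<close> of the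
  simplex, with \<open>D\<^sub>j\<close> the derivative in \<open>y\<^sub>j\<close> at fixed \<open>\<xi>\<close>.
\<close>

lemma flux_scaled_dy_sym:
  "(\<Sum>j\<in>UNIV. snd z $ j * (flux j u z * scaled_dy j v z))
    = (\<Sum>j\<in>UNIV. snd z $ j * (flux j v z * scaled_dy j u z))"
proof -
  have "(\<Sum>j\<in>UNIV. snd z $ j * (flux j f z * scaled_dy j g z))
    = slack z * (\<Sum>j\<in>UNIV. snd z $ j * (dy j f z * dy j g z)) - euler_x g z * euler_y f z
      - slack z * euler_xy f z * euler_y g z + (1 - slack z) * (euler_xy f z * euler_x g z)" for f g
  proof -
    have "(\<Sum>j\<in>UNIV. snd z $ j * (flux j f z * scaled_dy j g z))
      = (\<Sum>j\<in>UNIV. slack z * (snd z $ j * (dy j f z * dy j g z)) - euler_x g z * (snd z $ j * dy j f z)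
        - slack z * euler_xy f z * (snd z $ j * dy j g z) + snd z $ j * (euler_xy f z * euler_x g z))"
      by (rule sum.cong) (simp_all add: flux_def scaled_dy_def algebra_simps)
    also have "\<dots> = slack z * (\<Sum>j\<in>UNIV. snd z $ j * (dy j f z * dy j g z)) - euler_x g z * euler_y f z
      - slack z * euler_xy f z * euler_y g z + (1 - slack z) * (euler_xy f z * euler_x g z)"
      unfolding sum.distrib sum_subtractf sum_distrib_left[symmetric] sum_distrib_right[symmetric]
        sum_y euler_y_def[symmetric] by simp
    finally show ?thesis .
  qed
  from this[of u v] this[of v u] show ?thesis
    by (simp add: euler_xy_def algebra_simps)
qed

text \<open>
  Symmetry uses nothing about the integral but linearity on polynomials and the two rules
  \<open>M_dx\<close> and \<open>M_dy\<close>, which say that the adjoint of a derivative is known. The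
  functional \<open>M\<close> stands for integration against the weight divided by \<open>1 - |y|\<close>, so
  that the inner product of \<open>f\<close> and \<open>g\<close> is \<open>M (slack * f * g)\<close>.
\<close>

context
  fixes M :: "((real ^ 'd1) \<times> (real ^ 'd2) \<Rightarrow> real) \<Rightarrow> real"
    and \<kappa> :: "real ^ ('d2::finite option)"
  assumes M_add: "\<And>f g. polyfun f \<Longrightarrow> polyfun g \<Longrightarrow> M (\<lambda>z. f z + g z) = M f + M g"
    and M_cmult: "\<And>f c. polyfun f \<Longrightarrow> M (\<lambda>z. c * f z) = c * M f"
    and M_dx: "\<And>f i. polyfun f \<Longrightarrow> M (\<lambda>z. slack z ^ 2 * dx i f z - 2 * fst z $ i * f z) = 0"
    and M_dy: "\<And>f j. polyfun f \<Longrightarrow> M (\<lambda>z. snd z $ j * scaled_dy j f z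
      + ((\<kappa> $ Some j + 1) * slack z - (\<kappa> $ None + real CARD('d1)) * snd z $ j) * f z) = 0"
begin

lemma M_zero: "M (\<lambda>z. 0) = 0"
  using M_cmult[OF polyfun_const, of 0 0] by simp

lemma M_sum: "(\<And>i. i \<in> A \<Longrightarrow> polyfun (f i)) \<Longrightarrow> M (\<lambda>z. \<Sum>i\<in>A. f i z) = (\<Sum>i\<in>A. M (f i))"
  by (induction A rule: infinite_finite_induct) (auto simp: M_zero M_add polyfun_sum)

lemma M_eq_minus:
  assumes "M (\<lambda>z. f z + g z) = 0" "polyfun f" "polyfun g"
  shows "M f = - M g"
  using assms by (simp add: M_add)

text \<open>
  This is the rule \<open>M_dx\<close> for the products \<open>dx i u * v\<close>, summed over \<open>i\<close>. The right side is
  symmetric in \<open>u\<close> and \<open>v\<close>.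
\<close>

lemma M_hermite_op:
  assumes u: "polyfun u" and v: "polyfun v"
  shows "M (\<lambda>z. hermite_op u z * v z) = - M (\<lambda>z. 1/2 * (slack z ^ 2 * (\<Sum>i\<in>UNIV. dx i u z * dx i v z)))"
proof (rule M_eq_minus)
  have "(\<lambda>z. hermite_op u z * v z + 1/2 * (slack z ^ 2 * (\<Sum>i\<in>UNIV. dx i u z * dx i v z)))
     = (\<lambda>z. 1/2 * (\<Sum>i\<in>UNIV. slack z ^ 2 * dx i (\<lambda>z. dx i u z * v z) z - 2 * fst z $ i * (dx i u z * v z)))"
  proof
    fix z
    have "(\<Sum>i\<in>UNIV. slack z ^ 2 * dx i (\<lambda>z. dx i u z * v z) z - 2 * fst z $ i * (dx i u z * v z))
      = (\<Sum>i\<in>UNIV. slack z ^ 2 * v z * dx i (dx i u) z + slack z ^ 2 * (dx i u z * dx i v z)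
          - 2 * v z * (fst z $ i * dx i u z))"
      by (rule sum.cong) (simp_all add: dx_mult polyfun_dx u v algebra_simps)
    also have "\<dots> = slack z ^ 2 * v z * laplace_x u z + slack z ^ 2 * (\<Sum>i\<in>UNIV. dx i u z * dx i v z)
          - 2 * v z * euler_x u z"
      by (simp add: sum.distrib sum_subtractf sum_distrib_left laplace_x_def euler_x_def)
    finally show "hermite_op u z * v z + 1/2 * (slack z ^ 2 * (\<Sum>i\<in>UNIV. dx i u z * dx i v z))
      = 1/2 * (\<Sum>i\<in>UNIV. slack z ^ 2 * dx i (\<lambda>z. dx i u z * v z) z - 2 * fst z $ i * (dx i u z * v z))"
      by (simp add: hermite_op_def algebra_simps)
  qed
  then show "M (\<lambda>z. hermite_op u z * v z + 1/2 * (slack z ^ 2 * (\<Sum>i\<in>UNIV. dx i u z * dx i v z))) = 0"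
    using u v by (simp only: M_cmult M_sum M_dx polyfun_intros) simp
qed (intro polyfun_intros u v)+

lemma M_hermite_op_sym:
  "polyfun u \<Longrightarrow> polyfun v \<Longrightarrow> M (\<lambda>z. hermite_op u z * v z) = M (\<lambda>z. hermite_op v z * u z)"
  by (subst (1 2) M_hermite_op) (simp_all add: mult.commute)

text \<open>
  This is the rule \<open>M_dy\<close> for the products \<open>flux j u * v\<close>, summed over \<open>j\<close>; the definition of
  \<open>jacobi_op\<close> collects exactly the terms in which \<open>v\<close> is not differentiated.
\<close>

lemma M_jacobi_op:
  assumes u: "polyfun u" and v: "polyfun v"
  shows "M (\<lambda>z. jacobi_op \<kappa> u z * v z) = - M (\<lambda>z. \<Sum>j\<in>UNIV. snd z $ j * (flux j u z * scaled_dy j v z))"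
proof (rule M_eq_minus)
  have "scaled_dy j (\<lambda>z. flux j u z * v z) z = scaled_dy j (flux j u) z * v z + flux j u z * scaled_dy j v z"
    for j and z :: "(real ^ 'd1) \<times> (real ^ 'd2)"
    using u v by (simp add: scaled_dy_def dy_mult euler_x_def dx_mult polyfun_flux algebra_simps
        sum.distrib sum_distrib_left)
  then have "(\<lambda>z. jacobi_op \<kappa> u z * v z + (\<Sum>j\<in>UNIV. snd z $ j * (flux j u z * scaled_dy j v z)))
    = (\<lambda>z. \<Sum>j\<in>UNIV. snd z $ j * scaled_dy j (\<lambda>z. flux j u z * v z) z
      + ((\<kappa> $ Some j + 1) * slack z - (\<kappa> $ None + real CARD('d1)) * snd z $ j) * (flux j u z * v z))"
    by (simp only: jacobi_op_def sum_distrib_right sum.distrib[symmetric] distrib_left distrib_right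
        mult.assoc add.assoc) (simp add: mult_ac add_ac)
  then show "M (\<lambda>z. jacobi_op \<kappa> u z * v z + (\<Sum>j\<in>UNIV. snd z $ j * (flux j u z * scaled_dy j v z))) = 0"
    using u v by (simp only: M_sum M_dy polyfun_intros) simp
qed (intro polyfun_intros u v)+

text \<open>
  In the decomposition of \<open>slack_rtri_op\<close> every summand is symmetric for \<open>M\<close>: the
  Jacobi part by its Dirichlet form, \<open>L\<^sup>2\<close> and \<open>L\<close> because \<open>L\<close> is.
\<close>

lemma M_rtri_op_sym:
  assumes u: "polyfun u" and v: "polyfun v"
  shows "M (\<lambda>z. slack z * rtri_op \<kappa> u z * v z) = M (\<lambda>z. slack z * rtri_op \<kappa> v z * u z)"
proof -
  define c where "c = \<kappa> $ None + real CARD('d1)"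
  have expand: "M (\<lambda>z. slack z * rtri_op \<kappa> f z * g z) = M (\<lambda>z. jacobi_op \<kappa> f z * g z)
      - M (\<lambda>z. hermite_op f z * hermite_op g z) + c * M (\<lambda>z. hermite_op f z * g z)"
    if f: "polyfun f" and g: "polyfun g" for f g
  proof -
    have "(\<lambda>z. slack z * rtri_op \<kappa> f z * g z) = (\<lambda>z. (jacobi_op \<kappa> f z * g z
      + (-1) * (hermite_op (hermite_op f) z * g z)) + c * (hermite_op f z * g z))"
      by (simp add: slack_rtri_op[OF f] c_def[symmetric] algebra_simps)
    then have "M (\<lambda>z. slack z * rtri_op \<kappa> f z * g z) = M (\<lambda>z. (jacobi_op \<kappa> f z * g z
      + (-1) * (hermite_op (hermite_op f) z * g z)) + c * (hermite_op f z * g z))"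
      by (rule arg_cong)
    also have "\<dots> = M (\<lambda>z. jacobi_op \<kappa> f z * g z)
      + (-1) * M (\<lambda>z. hermite_op (hermite_op f) z * g z) + c * M (\<lambda>z. hermite_op f z * g z)"
      using f g by (simp only: M_add M_cmult polyfun_intros)
    also have "M (\<lambda>z. hermite_op (hermite_op f) z * g z) = M (\<lambda>z. hermite_op f z * hermite_op g z)"
      using M_hermite_op_sym[of "hermite_op f" g] f g by (simp add: polyfun_hermite_op mult.commute)
    finally show ?thesis by simp
  qed
  show ?thesis
    unfolding expand[OF u v] expand[OF v u] M_jacobi_op[OF u v] M_jacobi_op[OF v u]
      M_hermite_op_sym[OF u v] flux_scaled_dy_sym[of _ u v]
    by (simp add: mult.commute[of "hermite_op u _"])
qed

end

section \<open>Integrals of directional derivatives\<close>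

text \<open>
  If \<open>G\<close> is the derivative of \<open>F\<close> in direction \<open>b\<close> along almost every line,
  then \<open>\<integral> G = 0\<close>. Integrate \<open>F (z + b) - F z = \<integral>\<^sub>0\<^sup>1 G (z + s b) ds\<close> over all
  \<open>z\<close>: by translation invariance the left side gives \<open>0\<close> and, after exchanging the
  integrals, the right side gives \<open>\<integral> G\<close>. No boundary terms have to be discussed: a weight
  cut off to its domain enters only through continuity of \<open>F\<close> along lines.
\<close>

lemma integral_zero_of_line_primitive:
  fixes F G :: "'a::euclidean_space \<Rightarrow> real"
  assumes F: "integrable lborel F" and G: "integrable lborel G"
    and prim: "AE z in lborel. ((\<lambda>s. G (z + s *\<^sub>R b)) has_integral (F (z + b) - F z)) {0..1}"
  shows "has_bochner_integral lborel G 0"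
proof -
  have [measurable]: "F \<in> borel_measurable borel" "G \<in> borel_measurable borel"
    using F G by (auto dest: borel_measurable_integrable)
  have shift: "has_bochner_integral lborel (\<lambda>z. f (z + c)) (\<integral>z. f z \<partial>lborel)"
    if "integrable lborel f" for f :: "'a \<Rightarrow> real" and c
  proof -
    have "integrable (distr lborel borel ((+) c)) f" "(\<integral>z. f z \<partial>distr lborel borel ((+) c)) = (\<integral>z. f z \<partial>lborel)"
      unfolding lborel_distr_plus using that by simp_all
    then have "has_bochner_integral lborel (\<lambda>z. f (c + z)) (\<integral>z. f z \<partial>lborel)"
      using borel_measurable_integrable[OF that]
      by (simp add: has_bochner_integral_iff integrable_distr_eq integral_distr)
    then show ?thesis by (simp add: add.commute)
  qed
  define g where "g = (\<lambda>(z, s :: real). indicator {0..1} s * G (z + s *\<^sub>R b))"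
  have g [measurable]: "g \<in> borel_measurable (lborel \<Otimes>\<^sub>M lborel)"
    unfolding g_def by measurable
  have "(\<integral>\<^sup>+p. norm (g p) \<partial>(lborel \<Otimes>\<^sub>M lborel)) = (\<integral>\<^sup>+s. \<integral>\<^sup>+z. norm (g (z, s)) \<partial>lborel \<partial>lborel)"
    by (rule lborel_pair.nn_integral_snd[symmetric]) measurable
  also have "\<dots> = (\<integral>\<^sup>+s. indicator {0..1::real} s * (\<integral>\<^sup>+z. norm (G z) \<partial>lborel) \<partial>lborel)"
  proof (rule nn_integral_cong)
    fix s :: real
    have "(\<integral>\<^sup>+z. norm (G (z + s *\<^sub>R b)) \<partial>lborel)
        = (\<integral>\<^sup>+z. norm (G z) \<partial>distr lborel borel ((+) (s *\<^sub>R b)))"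
      by (subst nn_integral_distr) (auto simp: add.commute)
    then show "(\<integral>\<^sup>+z. norm (g (z, s)) \<partial>lborel) = indicator {0..1} s * (\<integral>\<^sup>+z. norm (G z) \<partial>lborel)"
      by (auto simp: g_def lborel_distr_plus split: split_indicator)
  qed
  also have "\<dots> = (\<integral>\<^sup>+z. norm (G z) \<partial>lborel)"
    by (simp add: nn_integral_multc)
  also have "\<dots> < \<infinity>"
    using G by (simp add: integrable_iff_bounded)
  finally have int_g: "integrable (lborel \<Otimes>\<^sub>M lborel) g"
    by (intro integrableI_bounded g) simp
  have "(\<integral>z. \<integral>s. g (z, s) \<partial>lborel \<partial>lborel) = (\<integral>z. F (z + b) - F z \<partial>lborel)"
  proof (rule integral_cong_AE)
    have "AE z in lborel. integrable lborel (\<lambda>s. g (z, s))"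
      using lborel_pair.AE_integrable_fst'[OF int_g] .
    then show "AE z in lborel. (\<integral>s. g (z, s) \<partial>lborel) = F (z + b) - F z"
      using prim
    proof eventually_elim
      case (elim z)
      then have "set_integrable lborel {0..1} (\<lambda>s. G (z + s *\<^sub>R b))"
        by (simp add: set_integrable_def g_def)
      from set_borel_integral_eq_integral(2)[OF this] elim(2) show ?case
        by (simp add: set_lebesgue_integral_def g_def integral_unique)
    qed
  qed measurable
  also have "\<dots> = 0"
  proof -
    have "(\<integral>z. F (z + b) - F z \<partial>lborel) = (\<integral>z. F (z + b) \<partial>lborel) - (\<integral>z. F z \<partial>lborel)"
      using shift[OF F, of b] F by (intro Bochner_Integration.integral_diff) (auto simp: has_bochner_integral_iff)
    then show ?thesis using shift[OF F, of b] by (simp add: has_bochner_integral_iff)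
  qed
  finally have "0 = (\<integral>z. \<integral>s. g (z, s) \<partial>lborel \<partial>lborel)" by simp
  also have "\<dots> = (\<integral>s. \<integral>z. g (z, s) \<partial>lborel \<partial>lborel)"
    using lborel_pair.Fubini_integral[of "\<lambda>z s. g (z, s)"] int_g by simp
  also have "\<dots> = (\<integral>s. indicator {0..1::real} s * (\<integral>z. G z \<partial>lborel) \<partial>lborel)"
    using shift[OF G] by (intro Bochner_Integration.integral_cong refl) (simp add: g_def has_bochner_integral_iff)
  also have "\<dots> = (\<integral>z. G z \<partial>lborel)"
    by simp
  finally show ?thesis using G by (simp add: has_bochner_integral_iff)
qed

section \<open>Integrability of the weight\<close>

text \<open>
  Extending powers by zero to the negative half-line makes the characteristic function of the
  simplex a part of the weight, so that all integrals run over the whole space.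
\<close>

definition powpos :: "real \<Rightarrow> real \<Rightarrow> real" where
  "powpos p r = (if r > 0 then r powr p else 0)"

lemma powpos_nonneg: "0 \<le> powpos p r"
  by (simp add: powpos_def)

lemma powpos_measurable [measurable]: "powpos p \<in> borel_measurable borel"
  unfolding powpos_def[abs_def] by measurable

lemma powpos_mult: "s > 0 \<Longrightarrow> powpos p (s * r) = s powr p * powpos p r"
  by (auto simp: powpos_def powr_mult zero_less_mult_iff)

lemma nn_integral_powpos_exp_finite:
  assumes "p > -1"
  shows "(\<integral>\<^sup>+r. ennreal (powpos p r * exp (- r)) \<partial>lborel) < \<infinity>"
proof -
  have "((\<lambda>t. t powr (p + 1 - 1) / exp t) has_integral Gamma (p + 1)) {0..}"
    by (rule Gamma_integral_real) (use assms in simp)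
  then have "((\<lambda>r. powpos p r * exp (- r)) has_integral Gamma (p + 1)) {0..}"
    by (rule has_integral_eq[rotated]) (auto simp: powpos_def exp_minus divide_simps)
  then have "((\<lambda>r. powpos p r * exp (- r)) has_integral Gamma (p + 1)) UNIV"
    by (rule has_integral_on_superset) (auto simp: powpos_def)
  from nn_integral_has_integral_lborel[OF _ _ this] show ?thesis
    by (simp add: powpos_nonneg)
qed

lemma vec_nth_measurable [measurable]: "(\<lambda>y :: real ^ 'n. y $ i) \<in> borel_measurable borel"
  by (intro borel_measurable_continuous_onI continuous_intros)

lemma ysum_measurable [measurable]: "ysum \<in> borel_measurable borel"
  unfolding ysum_def[abs_def] by measurable

lemma Basis_vec_real: "(Basis :: (real ^ 'n) set) = range (\<lambda>i. axis i 1)"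
  by (auto simp: Basis_vec_def)

lemma prod_Basis_vec: "(\<Prod>b\<in>(Basis :: (real ^ 'n) set). f b) = (\<Prod>i\<in>UNIV. f (axis i 1))"
  by (simp add: Basis_vec_real prod.reindex inj_on_def axis_eq_axis)

lemma nn_integral_vec_prod:
  fixes f :: "'n::finite \<Rightarrow> real \<Rightarrow> real"
  assumes [measurable]: "\<And>i. f i \<in> borel_measurable borel" and nn: "\<And>i r. 0 \<le> f i r"
  shows "(\<integral>\<^sup>+y. ennreal (\<Prod>i\<in>UNIV. f i (y $ i)) \<partial>(lborel :: (real ^ 'n) measure))
    = (\<Prod>i\<in>UNIV. \<integral>\<^sup>+r. ennreal (f i r) \<partial>lborel)"
proof -
  define g where "g = (\<lambda>b :: real ^ 'n. \<lambda>r. ennreal (f (THE i. b = axis i 1) r))"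
  have g: "g (axis i 1) = (\<lambda>r. ennreal (f i r))" for i
    by (simp add: g_def axis_eq_axis)
  have "(\<integral>\<^sup>+y. (\<Prod>b\<in>Basis. g b (y \<bullet> b)) \<partial>lborel) = (\<Prod>b\<in>Basis. \<integral>\<^sup>+r. g b r \<partial>lborel)"
    by (rule nn_integral_lborel_prod) (auto simp: g_def)
  then show ?thesis
    by (simp add: prod_Basis_vec g inner_axis prod_ennreal nn)
qed

lemma nn_integral_scaleR:
  fixes f :: "'a::euclidean_space \<Rightarrow> ennreal"
  assumes [measurable]: "f \<in> borel_measurable borel" and c: "c > 0"
  shows "(\<integral>\<^sup>+x. f x \<partial>lborel) = ennreal (c ^ DIM('a)) * (\<integral>\<^sup>+x. f (c *\<^sub>R x) \<partial>lborel)"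
proof -
  have "(\<integral>\<^sup>+x. f x \<partial>lborel)
      = (\<integral>\<^sup>+x. f x \<partial>density (distr lborel borel (\<lambda>x. 0 + c *\<^sub>R x)) (\<lambda>_. \<bar>c\<bar>^DIM('a)))"
    using lborel_affine[of c "0 :: 'a"] c by simp
  also have "\<dots> = ennreal (c ^ DIM('a)) * (\<integral>\<^sup>+x. f (c *\<^sub>R x) \<partial>lborel)"
    using c by (simp add: nn_integral_density nn_integral_distr nn_integral_cmult)
  finally show ?thesis .
qed

lemma nn_integral_gauss_finite:
  assumes a: "a > 0"
  shows "(\<integral>\<^sup>+x. ennreal (exp (- a * (norm x)\<^sup>2)) \<partial>(lborel :: (real ^ 'n::finite) measure)) < \<infinity>"
proof -
  have "(\<integral>\<^sup>+r. ennreal (exp (- a * r\<^sup>2)) \<partial>lborel) < \<infinity>"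
  proof -
    define \<sigma> where "\<sigma> = 1 / sqrt (2 * a)"
    have \<sigma>: "\<sigma> > 0" "2 * \<sigma>\<^sup>2 = 1 / a" using a by (auto simp: \<sigma>_def power_divide)
    have "integrable lborel (\<lambda>r. sqrt (2 * pi * \<sigma>\<^sup>2) * normal_density 0 \<sigma> r)"
      using \<sigma> by simp
    also have "(\<lambda>r. sqrt (2 * pi * \<sigma>\<^sup>2) * normal_density 0 \<sigma> r) = (\<lambda>r. exp (- a * r\<^sup>2))"
      using \<sigma> a by (auto simp: normal_density_def)
    finally show ?thesis by (simp add: integrable_iff_bounded)
  qed
  moreover have "exp (- a * (norm x)\<^sup>2) = (\<Prod>i\<in>UNIV. exp (- a * (x $ i)\<^sup>2))" for x :: "real ^ 'n"
    by (simp add: norm_vec_def L2_set_def sum_nonneg exp_sum[symmetric] sum_distrib_left[symmetric] sum_negf)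
  ultimately show ?thesis
    by (simp only:, subst nn_integral_vec_prod) (auto simp: power_less_top_ennreal)
qed

text \<open>
  Let \<open>H s\<close> be the same integral with \<open>1\<close> replaced by \<open>s\<close>. Scaling shows that
  \<open>H s\<close> is \<open>H 1\<close> times a power of \<open>s\<close>. On the other hand, exchanging the order of
  integration and substituting \<open>r = s - |y|\<close> turns \<open>\<integral> exp (- s) H s ds\<close> into a product of
  Gamma integrals, which is finite. So \<open>H 1\<close> cannot be infinite.
\<close>

lemma nn_integral_dirichlet_finite:
  fixes p :: "'n::finite \<Rightarrow> real"
  assumes p: "\<And>i. p i > -1" and q: "q > -1"
  shows "(\<integral>\<^sup>+y. ennreal ((\<Prod>i\<in>UNIV. powpos (p i) (y $ i)) * powpos q (1 - ysum y)) \<partial>lborel) < \<infinity>"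
proof (rule ccontr)
  define H where "H = (\<lambda>s. \<integral>\<^sup>+y.
    ennreal ((\<Prod>i\<in>UNIV. powpos (p i) (y $ i)) * powpos q (s - ysum y)) \<partial>lborel)"
  assume "\<not> ?thesis"
  then have H1: "H 1 = \<infinity>" by (simp add: H_def less_top[symmetric])
  have H: "H s = \<infinity>" if s: "s > 0" for s
  proof -
    have "H s = ennreal (s ^ CARD('n)) * (\<integral>\<^sup>+y.
      ennreal ((\<Prod>i\<in>UNIV. powpos (p i) ((s *\<^sub>R y) $ i)) * powpos q (s - ysum (s *\<^sub>R y))) \<partial>lborel)"
      unfolding H_def by (subst nn_integral_scaleR[OF _ s]) simp_all
    also have "(\<integral>\<^sup>+y.
      ennreal ((\<Prod>i\<in>UNIV. powpos (p i) ((s *\<^sub>R y) $ i)) * powpos q (s - ysum (s *\<^sub>R y))) \<partial>lborel)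
      = (\<integral>\<^sup>+y. ennreal ((\<Prod>i\<in>UNIV. s powr p i) * s powr q)
          * ennreal ((\<Prod>i\<in>UNIV. powpos (p i) (y $ i)) * powpos q (1 - ysum y)) \<partial>lborel)"
    proof (rule nn_integral_cong)
      fix y :: "real ^ 'n"
      have "s - ysum (s *\<^sub>R y) = s * (1 - ysum y)"
        by (simp add: ysum_def sum_distrib_left algebra_simps)
      then show "ennreal ((\<Prod>i\<in>UNIV. powpos (p i) ((s *\<^sub>R y) $ i)) * powpos q (s - ysum (s *\<^sub>R y)))
        = ennreal ((\<Prod>i\<in>UNIV. s powr p i) * s powr q)
          * ennreal ((\<Prod>i\<in>UNIV. powpos (p i) (y $ i)) * powpos q (1 - ysum y))"
        by (subst ennreal_mult[symmetric])
          (auto simp: powpos_mult[OF s] prod.distrib powpos_nonneg prod_nonneg mult_ac)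
    qed
    also have "\<dots> = ennreal ((\<Prod>i\<in>UNIV. s powr p i) * s powr q) * H 1"
      unfolding H_def by (rule nn_integral_cmult) measurable
    moreover have "0 < (\<Prod>i\<in>UNIV. s powr p i) * s powr q"
      using s by (simp add: prod_pos)
    ultimately show ?thesis
      using s by (simp add: H1 ennreal_mult_top ennreal_mult_eq_top_iff ennreal_eq_0_iff not_le)
  qed
  have "\<infinity> = (\<integral>\<^sup>+s. \<infinity> * indicator {1..2::real} s \<partial>lborel)"
    by (subst nn_integral_cmult_indicator) auto
  also have "\<dots> \<le> (\<integral>\<^sup>+s. ennreal (exp (- s)) * H s \<partial>lborel)"
    by (rule nn_integral_mono) (auto simp: H ennreal_mult_top split: split_indicator)
  also have "\<dots> = (\<integral>\<^sup>+s. \<integral>\<^sup>+y. ennreal (exp (- s)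
      * ((\<Prod>i\<in>UNIV. powpos (p i) (y $ i)) * powpos q (s - ysum y))) \<partial>lborel \<partial>lborel)"
    unfolding H_def by (simp add: nn_integral_cmult[symmetric] ennreal_mult' )
  also have "\<dots> = (\<integral>\<^sup>+y. \<integral>\<^sup>+s. ennreal (exp (- s)
      * ((\<Prod>i\<in>UNIV. powpos (p i) (y $ i)) * powpos q (s - ysum y))) \<partial>lborel \<partial>lborel)"
    by (rule lborel_pair.Fubini') measurable
  also have "\<dots> = (\<integral>\<^sup>+y. ennreal (\<Prod>i\<in>UNIV. powpos (p i) (y $ i) * exp (- (y $ i)))
      * (\<integral>\<^sup>+r. ennreal (powpos q r * exp (- r)) \<partial>lborel) \<partial>lborel)"
  proof (rule nn_integral_cong)
    fix y :: "real ^ 'n"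
    have "(\<Prod>i\<in>UNIV. exp (- (y $ i))) = exp (- ysum y)"
      by (simp add: ysum_def exp_sum[symmetric] sum_negf)
    then have ex: "exp (- (ysum y + 1 * r)) * ((\<Prod>i\<in>UNIV. powpos (p i) (y $ i)) * powpos q (ysum y + 1 * r - ysum y))
      = (\<Prod>i\<in>UNIV. powpos (p i) (y $ i) * exp (- (y $ i))) * (powpos q r * exp (- r))" for r
      by (simp only: prod.distrib minus_add_distrib exp_add) simp
    have "(\<integral>\<^sup>+s. ennreal (exp (- s) * ((\<Prod>i\<in>UNIV. powpos (p i) (y $ i)) * powpos q (s - ysum y))) \<partial>lborel)
      = (\<integral>\<^sup>+r. ennreal (exp (- (ysum y + 1 * r)) * ((\<Prod>i\<in>UNIV. powpos (p i) (y $ i))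
            * powpos q (ysum y + 1 * r - ysum y))) \<partial>lborel)"
      by (subst nn_integral_real_affine[of _ 1 "ysum y"]) auto
    also have "\<dots> = (\<integral>\<^sup>+r. ennreal (\<Prod>i\<in>UNIV. powpos (p i) (y $ i) * exp (- (y $ i)))
      * ennreal (powpos q r * exp (- r)) \<partial>lborel)"
      unfolding ex by (rule nn_integral_cong, rule ennreal_mult) (auto simp: powpos_nonneg prod_nonneg)
    also have "\<dots> = ennreal (\<Prod>i\<in>UNIV. powpos (p i) (y $ i) * exp (- (y $ i)))
      * (\<integral>\<^sup>+r. ennreal (powpos q r * exp (- r)) \<partial>lborel)"
      by (rule nn_integral_cmult) measurable
    finally show "(\<integral>\<^sup>+s. ennreal (exp (- s) * ((\<Prod>i\<in>UNIV. powpos (p i) (y $ i)) * powpos q (s - ysum y))) \<partial>lborel) = \<dots>" .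
  qed
  also have "\<dots> = (\<Prod>i\<in>UNIV. \<integral>\<^sup>+r. ennreal (powpos (p i) r * exp (- r)) \<partial>lborel)
      * (\<integral>\<^sup>+r. ennreal (powpos q r * exp (- r)) \<partial>lborel)"
    by (subst nn_integral_multc, measurable, subst nn_integral_vec_prod) (auto simp: powpos_nonneg)
  also have "\<dots> < \<infinity>"
    using nn_integral_powpos_exp_finite[OF p] nn_integral_powpos_exp_finite[OF q]
    by (auto simp: ennreal_mult_eq_top_iff ennreal_prod_eq_top less_top[symmetric])
  finally show False by simp
qed

text \<open>
  For \<open>a = 1\<close> this is the weight divided by \<open>1 - |y|\<close> and cut off to the interior of the
  domain. Smaller \<open>a\<close> give integrable majorants that absorb polynomial factors in \<open>x\<close>.
\<close>

definition rho :: "real ^ ('d2::finite option) \<Rightarrow> real \<Rightarrow> (real ^ 'd1) \<times> (real ^ 'd2) \<Rightarrow> real" where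
  "rho \<kappa> a z = (\<Prod>i\<in>UNIV. powpos (\<kappa> $ Some i) (snd z $ i)) * powpos (\<kappa> $ None - 1) (slack z)
    * exp (- a * ((norm (fst z))\<^sup>2 / (slack z)\<^sup>2))"

lemma slack_measurable [measurable]: "(slack :: (real ^ 'd1) \<times> (real ^ 'd2) \<Rightarrow> real) \<in> borel_measurable borel"
  by (rule polyfun_measurable) (rule polyfun_slack)

lemma snd_nth_measurable [measurable]:
  "(\<lambda>z :: (real ^ 'd1) \<times> (real ^ 'd2). snd z $ j) \<in> borel_measurable borel"
  by (rule polyfun_measurable) (rule polyfun_snd_nth)

lemma fst_nth_measurable [measurable]:
  "(\<lambda>z :: (real ^ 'd1) \<times> (real ^ 'd2). fst z $ j) \<in> borel_measurable borel"
  by (rule polyfun_measurable) (rule polyfun_fst_nth)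

lemma norm_fst_measurable [measurable]:
  "(\<lambda>z :: (real ^ 'd1) \<times> (real ^ 'd2). norm (fst z)) \<in> borel_measurable borel"
  by (intro borel_measurable_continuous_onI continuous_intros)

lemma rho_measurable [measurable]:
  "(rho \<kappa> a :: (real ^ 'd1) \<times> (real ^ 'd2) \<Rightarrow> real) \<in> borel_measurable borel"
  unfolding rho_def[abs_def] by measurable

lemma rho_nonneg: "0 \<le> rho \<kappa> a z"
  by (simp add: rho_def powpos_nonneg prod_nonneg)

lemma rho_neq_0_iff: "rho \<kappa> a z \<noteq> 0 \<longleftrightarrow> slack z > 0 \<and> (\<forall>i. snd z $ i > 0)"
  by (auto simp: rho_def powpos_def)

text \<open>
  Substituting \<open>x = (1 - |y|) \<xi>\<close> for fixed \<open>y\<close> splits off a Gaussian integral and leaves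
  a Dirichlet integral in which the exponent of \<open>1 - |y|\<close> is
  \<open>\<kappa> $ None - 1 + d\<^sub>1\<close>. Since \<open>d\<^sub>1 \<ge> 1\<close>, it is at least \<open>\<kappa> $ None\<close>; this is why the
  weight may be divided by \<open>1 - |y|\<close>.
\<close>

lemma integrable_rho:
  fixes \<kappa> :: "real ^ ('d2::finite option)"
  assumes \<kappa>: "\<And>j. \<kappa> $ j > -1" and a: "a > 0"
  shows "integrable lborel (rho \<kappa> a :: (real ^ 'd1) \<times> (real ^ 'd2) \<Rightarrow> real)"
proof -
  define C where "C = (\<integral>\<^sup>+x. ennreal (exp (- a * (norm x)\<^sup>2)) \<partial>(lborel :: (real ^ 'd1) measure))"
  have C: "C < \<infinity>" unfolding C_def by (rule nn_integral_gauss_finite[OF a])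
  let ?w = "\<lambda>q y. (\<Prod>i\<in>UNIV. powpos (\<kappa> $ Some i) (y $ i)) * powpos q (1 - ysum y)"
  let ?q = "\<kappa> $ None - 1"
  have "(\<integral>\<^sup>+z. ennreal (rho \<kappa> a z) \<partial>(lborel :: ((real ^ 'd1) \<times> (real ^ 'd2)) measure))
    = (\<integral>\<^sup>+y. \<integral>\<^sup>+x. ennreal (rho \<kappa> a (x :: real ^ 'd1, y)) \<partial>lborel \<partial>lborel)"
    unfolding lborel_prod[symmetric] by (rule lborel_pair.nn_integral_snd[symmetric])
      (simp add: lborel_prod)
  also have "\<dots> = (\<integral>\<^sup>+y. ennreal (?w (?q + CARD('d1)) y) * C \<partial>lborel)"
  proof (rule nn_integral_cong)
    fix y :: "real ^ 'd2"
    show "(\<integral>\<^sup>+x. ennreal (rho \<kappa> a (x :: real ^ 'd1, y)) \<partial>lborel) = ennreal (?w (?q + CARD('d1)) y) * C"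
    proof (cases "1 - ysum y > 0")
      case False
      then show ?thesis by (simp add: rho_def slack_def powpos_def)
    next
      case True
      define t where "t = 1 - ysum y"
      have t: "t > 0" using True by (simp add: t_def)
      have "(\<integral>\<^sup>+x. ennreal (rho \<kappa> a (x :: real ^ 'd1, y)) \<partial>lborel)
        = (\<integral>\<^sup>+x. ennreal (?w ?q y * exp (- a * ((norm (x :: real ^ 'd1))\<^sup>2 / t\<^sup>2))) \<partial>lborel)"
        by (simp add: rho_def slack_def t_def)
      also have "\<dots> = ennreal (t ^ CARD('d1)) * (\<integral>\<^sup>+x. ennreal (?w ?q y * exp (- a * ((norm (t *\<^sub>R (x :: real ^ 'd1)))\<^sup>2 / t\<^sup>2))) \<partial>lborel)"
        by (subst nn_integral_scaleR[OF _ t]) simp_all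
      also have "(\<integral>\<^sup>+x. ennreal (?w ?q y * exp (- a * ((norm (t *\<^sub>R (x :: real ^ 'd1)))\<^sup>2 / t\<^sup>2))) \<partial>lborel)
        = (\<integral>\<^sup>+x. ennreal (?w ?q y) * ennreal (exp (- a * (norm (x :: real ^ 'd1))\<^sup>2)) \<partial>lborel)"
        by (rule nn_integral_cong, subst ennreal_mult[symmetric])
          (use t in \<open>auto simp: powpos_nonneg prod_nonneg power_mult_distrib\<close>)
      also have "\<dots> = ennreal (?w ?q y) * C"
        unfolding C_def by (rule nn_integral_cmult) simp
      also have "ennreal (t ^ CARD('d1)) * (ennreal (?w ?q y) * C) = ennreal (t ^ CARD('d1) * ?w ?q y) * C"
        using t by (subst ennreal_mult) (auto simp: mult.assoc powpos_nonneg prod_nonneg)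
      also have "t ^ CARD('d1) * ?w ?q y = ?w (?q + CARD('d1)) y"
        using t by (simp add: powpos_def t_def[symmetric] powr_add powr_realpow)
      finally show ?thesis .
    qed
  qed
  also have "\<dots> = (\<integral>\<^sup>+y. ennreal (?w (?q + CARD('d1)) y) \<partial>lborel) * C"
    by (rule nn_integral_multc) measurable
  also have "\<dots> < \<infinity>"
  proof -
    have "real CARD('d1) \<ge> 1" by (simp add: Suc_leI)
    with \<kappa>[of None] have "?q + CARD('d1) > -1" by linarith
    then have "(\<integral>\<^sup>+y. ennreal (?w (?q + CARD('d1)) y) \<partial>lborel) < \<infinity>"
      by (intro nn_integral_dirichlet_finite \<kappa>)
    then show ?thesis using C by (auto simp: ennreal_mult_less_top)
  qed
  finally show ?thesis
    by (intro integrableI_bounded) (simp_all add: rho_nonneg)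
qed

text \<open>
  The coefficient \<open>a\<close> is arbitrary so that, in the induction, a new coordinate and the
  previous factor can use up one half of it each.
\<close>

lemma polyfun_le_exp:
  fixes f :: "(real ^ 'd1) \<times> (real ^ 'd2) \<Rightarrow> real"
  assumes "polyfun f" "a > 0"
  shows "\<exists>C\<ge>0. \<forall>z. slack z > 0 \<longrightarrow> (\<forall>i. snd z $ i > 0) \<longrightarrow> \<bar>f z\<bar> \<le> C * exp (a * (norm (fst z))\<^sup>2)"
proof -
  have "\<And>a. a > 0 \<Longrightarrow> \<exists>C\<ge>0. \<forall>z. slack z > 0 \<longrightarrow> (\<forall>i. snd z $ i > 0) \<longrightarrow> \<bar>f z\<bar> \<le> C * exp (a * (norm (fst z))\<^sup>2)"
    if "poly_deg k f" for k using that
  proof (induction rule: poly_deg.induct)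
    case (zero k)
    show ?case by (rule exI[of _ 0]) simp
  next
    case (const k c)
    have "\<bar>c\<bar> * 1 \<le> \<bar>c\<bar> * exp (a * (norm (fst z))\<^sup>2)" for z :: "(real ^ 'd1) \<times> (real ^ 'd2)"
      using const by (intro mult_left_mono) auto
    then show ?case by (intro exI[of _ "\<bar>c\<bar>"]) simp
  next
    case (add k f g)
    from add.IH(1)[OF add.prems] add.IH(2)[OF add.prems] obtain C D where
      "C \<ge> 0" "\<forall>z. slack z > 0 \<longrightarrow> (\<forall>i. snd z $ i > 0) \<longrightarrow> \<bar>f z\<bar> \<le> C * exp (a * (norm (fst z))\<^sup>2)"
      "D \<ge> 0" "\<forall>z. slack z > 0 \<longrightarrow> (\<forall>i. snd z $ i > 0) \<longrightarrow> \<bar>g z\<bar> \<le> D * exp (a * (norm (fst z))\<^sup>2)"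
      by blast
    then show ?case
      by (intro exI[of _ "C + D"] conjI allI impI)
        (auto simp: distrib_right intro: order_trans[OF abs_triangle_ineq add_mono])
  next
    case (coord k f b)
    from coord.IH[of "a / 2"] coord.prems obtain C where C: "C \<ge> 0"
      "\<And>z. slack z > 0 \<Longrightarrow> (\<forall>i. snd z $ i > 0) \<Longrightarrow> \<bar>f z\<bar> \<le> C * exp (a / 2 * (norm (fst z))\<^sup>2)"
      by auto
    define B where "B = 2 + 2 / a"
    have B: "B \<ge> 0" using coord.prems by (simp add: B_def)
    have "\<bar>(z \<bullet> b) * f z\<bar> \<le> (B * C) * exp (a * (norm (fst z))\<^sup>2)"
      if z: "slack z > 0" "\<forall>i. snd z $ i > 0" for z
    proof -
      let ?r = "norm (fst z)"
      have "norm (snd z) \<le> (\<Sum>i\<in>UNIV. \<bar>snd z $ i\<bar>)" by (rule norm_le_l1_cart)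
      also have "\<dots> = ysum (snd z)" using z(2) by (simp add: ysum_def less_imp_le)
      also have "\<dots> \<le> 1" using z(1) by (simp add: slack_def)
      finally have "\<bar>z \<bullet> b\<bar> \<le> 1 + ?r"
        using Basis_le_norm[OF coord.hyps(2), of z] norm_Pair_le[of "fst z" "snd z"] by simp
      also have "\<dots> \<le> B * exp (a / 2 * ?r\<^sup>2)"
      proof -
        have "1 + ?r \<le> 2 + ?r\<^sup>2"
          using sum_power2_ge_zero[of "?r - 1/2" 0] by (simp add: power2_eq_square algebra_simps)
        also have "\<dots> = 2 + (2 / a) * (a / 2 * ?r\<^sup>2)" using coord.prems by simp
        also have "\<dots> \<le> 2 * exp (a / 2 * ?r\<^sup>2) + (2 / a) * exp (a / 2 * ?r\<^sup>2)"
        proof (intro add_mono mult_left_mono)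
          show "a / 2 * ?r\<^sup>2 \<le> exp (a / 2 * ?r\<^sup>2)"
            using exp_ge_add_one_self[of "a / 2 * ?r\<^sup>2"] by linarith
          have "1 \<le> exp (a / 2 * ?r\<^sup>2)" using coord.prems by simp
          then show "2 \<le> 2 * exp (a / 2 * ?r\<^sup>2)" by simp
        qed (use coord.prems in simp)
        finally show ?thesis by (simp add: B_def distrib_right)
      qed
      finally have 1: "\<bar>z \<bullet> b\<bar> \<le> B * exp (a / 2 * ?r\<^sup>2)" .
      have "\<bar>(z \<bullet> b) * f z\<bar> \<le> (B * exp (a / 2 * ?r\<^sup>2)) * (C * exp (a / 2 * ?r\<^sup>2))"
        unfolding abs_mult by (intro mult_mono 1 C z) (use B C in auto)
      also have "\<dots> = (B * C) * (exp (a / 2 * ?r\<^sup>2) * exp (a / 2 * ?r\<^sup>2))" by simp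
      also have "exp (a / 2 * ?r\<^sup>2) * exp (a / 2 * ?r\<^sup>2) = exp (a * ?r\<^sup>2)"
        by (simp add: exp_add[symmetric])
      finally show ?thesis .
    qed
    with B C(1) show ?case by (intro exI[of _ "B * C"]) simp
  qed
  then show ?thesis using assms by (auto simp: polyfun_def)
qed

text \<open>
  Since \<open>1 - |y| \<le> 1\<close>, the exponent \<open>\<parallel>x\<parallel>\<^sup>2\<close> is at most
  \<open>\<parallel>x\<parallel>\<^sup>2 / (1 - |y|)\<^sup>2\<close>. One quarter of the Gaussian exponent pays for \<open>f\<close>, one
  quarter for \<open>h\<close>, and one half is left for the majorant.
\<close>

lemma integrable_polyfun_rho_aux:
  fixes h :: "(real ^ 'd1) \<times> (real ^ 'd2) \<Rightarrow> real"
  assumes \<kappa>: "\<And>j. \<kappa> $ j > -1" and f: "polyfun f" and h: "h \<in> borel_measurable borel"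
    and le: "\<And>z. slack z > 0 \<Longrightarrow> \<bar>h z\<bar> \<le> 4 * exp (1/4 * ((norm (fst z))\<^sup>2 / (slack z)\<^sup>2))"
  shows "integrable lborel (\<lambda>z. h z * f z * rho \<kappa> 1 z)"
proof -
  obtain C where C: "C \<ge> 0" "\<And>z. slack z > 0 \<Longrightarrow> (\<forall>i. snd z $ i > 0) \<Longrightarrow> \<bar>f z\<bar> \<le> C * exp (1/4 * (norm (fst z))\<^sup>2)"
    using polyfun_le_exp[OF f, of "1/4"] by auto
  have [measurable]: "f \<in> borel_measurable borel" "h \<in> borel_measurable borel"
    using polyfun_measurable[OF f] h by auto
  show ?thesis
  proof (rule Bochner_Integration.integrable_bound)
    show "integrable lborel (\<lambda>z. 4 * C * rho \<kappa> (1/2) z)"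
      by (intro integrable_mult_right integrable_rho \<kappa>) simp
    show "AE z in lborel. norm (h z * f z * rho \<kappa> 1 z) \<le> norm (4 * C * rho \<kappa> (1/2) z)"
    proof (rule AE_I2)
      fix z :: "(real ^ 'd1) \<times> (real ^ 'd2)"
      show "norm (h z * f z * rho \<kappa> 1 z) \<le> norm (4 * C * rho \<kappa> (1/2) z)"
      proof (cases "rho \<kappa> 1 z = 0")
        case False
        then have z: "slack z > 0" "\<forall>i. snd z $ i > 0" by (auto simp: rho_neq_0_iff)
        let ?x = "(norm (fst z))\<^sup>2 / (slack z)\<^sup>2"
        have "ysum (snd z) \<ge> 0" unfolding ysum_def using z(2) by (intro sum_nonneg) (auto simp: less_imp_le)
        then have "(slack z)\<^sup>2 \<le> 1" using z(1) by (auto simp: slack_def power_le_one)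
        then have "(norm (fst z))\<^sup>2 \<le> ?x"
          using z(1) by (simp add: pos_le_divide_eq mult_left_le)
        then have "\<bar>f z\<bar> \<le> C * exp (1/4 * ?x)"
          by (intro order_trans[OF C(2)[OF z]] mult_left_mono C) simp
        then have "\<bar>h z\<bar> * \<bar>f z\<bar> \<le> (4 * exp (1/4 * ?x)) * (C * exp (1/4 * ?x))"
          by (intro mult_mono le z) auto
        also have "\<dots> = 4 * C * (exp (1/4 * ?x) * exp (1/4 * ?x))" by simp
        also have "exp (1/4 * ?x) * exp (1/4 * ?x) = exp (1/2 * ?x)" by (simp add: exp_add[symmetric])
        finally have "\<bar>h z\<bar> * \<bar>f z\<bar> * rho \<kappa> 1 z \<le> 4 * C * exp (1/2 * ?x) * rho \<kappa> 1 z"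
          by (rule mult_right_mono) (rule rho_nonneg)
        also have "exp (1/2 * ?x) * rho \<kappa> 1 z = rho \<kappa> (1/2) z"
        proof -
          have "exp (1/2 * ?x) * exp (- 1 * ?x) = exp (- (1/2) * ?x)"
            unfolding exp_add[symmetric] by (rule arg_cong[where f = exp]) (simp add: field_simps)
          then show ?thesis by (simp only: rho_def mult.left_commute[of "exp (1/2 * ?x)"])
        qed
        then have "4 * C * exp (1/2 * ?x) * rho \<kappa> 1 z = 4 * C * rho \<kappa> (1/2) z" by (simp add: mult.assoc)
        finally show ?thesis using C(1) by (simp add: abs_mult rho_nonneg)
      qed simp
    qed
  qed measurable
qed

lemma integrable_polyfun_rho:
  fixes f :: "(real ^ 'd1) \<times> (real ^ 'd2) \<Rightarrow> real"
  assumes \<kappa>: "\<And>j. \<kappa> $ j > -1" and f: "polyfun f"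
  shows "integrable lborel (\<lambda>z. f z * rho \<kappa> 1 z)"
proof -
  have e: "\<bar>1\<bar> \<le> 4 * exp (1/4 * r)" if "r \<ge> 0" for r :: real
    using that exp_ge_add_one_self[of "1/4 * r"] by linarith
  have "integrable lborel (\<lambda>z. 1 * f z * rho \<kappa> 1 z)"
  proof (rule integrable_polyfun_rho_aux[OF \<kappa> f])
    show "\<bar>1\<bar> \<le> 4 * exp (1/4 * ((norm (fst z))\<^sup>2 / (slack z)\<^sup>2))" for z :: "(real ^ 'd1) \<times> (real ^ 'd2)"
      by (rule e) simp
  qed simp
  then show ?thesis by simp
qed

lemma integrable_norm_polyfun_rho:
  assumes \<kappa>: "\<And>j. \<kappa> $ j > -1" and f: "polyfun f"
  shows "integrable lborel (\<lambda>z. (norm (fst z))\<^sup>2 / (slack z)\<^sup>2 * f z * rho \<kappa> 1 z)"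
proof (rule integrable_polyfun_rho_aux[OF \<kappa> f])
  have e: "\<bar>r\<bar> \<le> 4 * exp (1/4 * r)" if "r \<ge> 0" for r :: real
    using that exp_ge_add_one_self[of "1/4 * r"] by linarith
  show "\<bar>(norm (fst z))\<^sup>2 / (slack z)\<^sup>2\<bar> \<le> 4 * exp (1/4 * ((norm (fst z))\<^sup>2 / (slack z)\<^sup>2))" for z by (rule e) simp
qed measurable

section \<open>Integration by parts for the weight\<close>

text \<open>
  The extra factor \<open>r\<close> makes the function continuous at \<open>0\<close> for every exponent
  \<open>p > -1\<close>. Only the origin is exceptional for differentiability.
\<close>

lemma DERIV_powpos:
  assumes "r \<noteq> 0"
  shows "((\<lambda>r. r * powpos p r) has_real_derivative (p + 1) * powpos p r) (at r)"
proof (cases "r > 0")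
  case True
  have "((\<lambda>r. r powr (p + 1)) has_real_derivative (p + 1) * powpos p r) (at r)"
    using True by (auto intro!: derivative_eq_intros simp: powpos_def powr_diff)
  then show ?thesis
    by (rule has_field_derivative_transform_within_open[of _ _ _ "{0<..}"])
      (use True in \<open>auto simp: powpos_def powr_add\<close>)
next
  case False
  have "((\<lambda>r. 0) has_real_derivative (p + 1) * powpos p r) (at r)"
    using False by (auto simp: powpos_def)
  then show ?thesis
    by (rule has_field_derivative_transform_within_open[of _ _ _ "{..<0}"])
      (use False assms in \<open>auto simp: powpos_def\<close>)
qed

lemma continuous_powpos:
  assumes "p > -1"
  shows "continuous_on S (\<lambda>r. r * powpos p r)"
proof -
  have "(\<lambda>r. r * powpos p r) = (\<lambda>r. max 0 r powr (p + 1))"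
    by (auto simp: powpos_def powr_add max_def fun_eq_iff)
  then show ?thesis
    using assms by (simp only:) (intro continuous_on_powr' continuous_intros, auto)
qed

lemma DERIV_powpos_gauss:
  assumes "r \<noteq> 0"
  shows "((\<lambda>r. r * powpos q r * exp (- (A / r\<^sup>2))) has_real_derivative
    (q + 1 + 2 * (A / r\<^sup>2)) * (powpos q r * exp (- (A / r\<^sup>2)))) (at r)"
proof -
  have "((\<lambda>r. exp (- (A / r\<^sup>2))) has_real_derivative exp (- (A / r\<^sup>2)) * (2 * A / r ^ 3)) (at r)"
    using assms by (auto intro!: derivative_eq_intros simp: field_simps power2_eq_square power3_eq_cube)
  from DERIV_mult[OF DERIV_powpos[OF assms, of q] this] show ?thesis
    by (rule DERIV_cong) (use assms in \<open>simp add: field_simps power2_eq_square power3_eq_cube\<close>)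
qed

text \<open>
  The Gaussian factor beats every power at the origin, whatever the sign of \<open>q + 1\<close>; this
  covers exponents \<open>\<kappa> $ None\<close> of either sign.
\<close>

lemma continuous_powpos_gauss:
  assumes A: "A > 0"
  shows "continuous_on S (\<lambda>r. r * powpos q r * exp (- (A / r\<^sup>2)))"
proof -
  have "isCont (\<lambda>r. r * powpos q r * exp (- (A / r\<^sup>2))) r" for r
  proof (cases "r = 0")
    case False
    then show ?thesis using DERIV_powpos_gauss DERIV_isCont by blast
  next
    case True
    have "((\<lambda>r. r * r powr q * exp (- (A / r\<^sup>2))) \<longlongrightarrow> 0) (at_right 0)"
      using A by real_asymp
    then have "((\<lambda>r. r * powpos q r * exp (- (A / r\<^sup>2))) \<longlongrightarrow> 0) (at_right 0)"
      by (rule Lim_transform_eventually) (auto simp: powpos_def eventually_at_right_field intro!: exI[of _ 1])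
    moreover have "((\<lambda>r. r * powpos q r * exp (- (A / r\<^sup>2))) \<longlongrightarrow> 0) (at_left 0)"
      by (rule Lim_transform_eventually[of "\<lambda>_. 0"]) (auto simp: powpos_def eventually_at_left_field intro!: exI[of _ "-1"])
    ultimately show ?thesis
      using True by (simp add: isCont_def filterlim_split_at powpos_def)
  qed
  then show ?thesis by (simp add: continuous_at_imp_continuous_on)
qed

context
  fixes \<kappa> :: "real ^ ('d2::finite option)"
  assumes \<kappa>: "\<And>j. \<kappa> $ j > -1"
begin

text \<open>
  Here \<open>y\<close> is constant along the lines of integration, so the only factor of the weight that
  moves is the Gaussian. Integrability of the new term is an assumption because it can fail
  for general \<open>f\<close>: relative to \<open>x / (1 - |y|)\<close> there is one power of \<open>1 - |y|\<close> too
  many in the denominator.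
\<close>

lemma integral_dx_rho:
  fixes f :: "(real ^ 'd1::finite) \<times> (real ^ 'd2) \<Rightarrow> real"
  assumes f: "polyfun f"
    and int: "integrable lborel (\<lambda>z. fst z $ i / (slack z)\<^sup>2 * f z * rho \<kappa> 1 z)"
  shows "has_bochner_integral lborel (\<lambda>z. (dx i f z - 2 * (fst z $ i / (slack z)\<^sup>2 * f z)) * rho \<kappa> 1 z) 0"
proof (rule integral_zero_of_line_primitive[where F = "\<lambda>z. f z * rho \<kappa> 1 z" and b = "(axis i 1, 0)"])
  show "integrable lborel (\<lambda>z. f z * rho \<kappa> 1 z)"
    by (rule integrable_polyfun_rho[OF \<kappa> f])
  have "integrable lborel (\<lambda>z. dx i f z * rho \<kappa> 1 z - 2 * (fst z $ i / (slack z)\<^sup>2 * f z * rho \<kappa> 1 z))"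
    by (intro Bochner_Integration.integrable_diff integrable_mult_right int integrable_polyfun_rho[OF \<kappa>] polyfun_dx f)
  then show "integrable lborel (\<lambda>z. (dx i f z - 2 * (fst z $ i / (slack z)\<^sup>2 * f z)) * rho \<kappa> 1 z)"
    by (simp add: left_diff_distrib mult.assoc)
  let ?b = "(axis i 1, 0) :: (real ^ 'd1) \<times> (real ^ 'd2)"
  have "((\<lambda>s. (dx i f (z + s *\<^sub>R ?b) - 2 * (fst (z + s *\<^sub>R ?b) $ i / (slack (z + s *\<^sub>R ?b))\<^sup>2 * f (z + s *\<^sub>R ?b)))
      * rho \<kappa> 1 (z + s *\<^sub>R ?b)) has_integral
      (f (z + 1 *\<^sub>R ?b) * rho \<kappa> 1 (z + 1 *\<^sub>R ?b) - f (z + 0 *\<^sub>R ?b) * rho \<kappa> 1 (z + 0 *\<^sub>R ?b))) {0..1}" for z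
  proof (rule fundamental_theorem_of_calculus)
    fix s :: real
    define P where "P = (\<Prod>j\<in>UNIV. powpos (\<kappa> $ Some j) (snd z $ j)) * powpos (\<kappa> $ None - 1) (slack z)"
    have t: "slack (z + s *\<^sub>R ?b) = slack z" for s by (simp add: slack_def)
    have n: "(norm (fst z + s *\<^sub>R axis i 1))\<^sup>2 = (norm (fst z))\<^sup>2 + 2 * s * fst z $ i + s\<^sup>2" for s
      unfolding power2_norm_eq_inner
      by (simp add: inner_add_left inner_add_right inner_axis inner_axis' power2_eq_square algebra_simps)
    have rho: "rho \<kappa> 1 (z + s *\<^sub>R ?b) = P * exp (- (((norm (fst z))\<^sup>2 + 2 * s * fst z $ i + s\<^sup>2) / (slack z)\<^sup>2))" for s
    proof -
      have "fst (z + s *\<^sub>R ?b) = fst z + s *\<^sub>R axis i 1" "snd (z + s *\<^sub>R ?b) = snd z" by simp_all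
      then show ?thesis unfolding rho_def t P_def by (simp only: n mult_minus_left mult_1)
    qed
    have "((\<lambda>s. f (z + s *\<^sub>R ?b) * rho \<kappa> 1 (z + s *\<^sub>R ?b)) has_real_derivative
      (dx i f (z + s *\<^sub>R ?b) - 2 * (fst (z + s *\<^sub>R ?b) $ i / (slack (z + s *\<^sub>R ?b))\<^sup>2 * f (z + s *\<^sub>R ?b)))
      * rho \<kappa> 1 (z + s *\<^sub>R ?b)) (at s)"
    proof -
      have "((\<lambda>s. (norm (fst z))\<^sup>2 + 2 * s * fst z $ i + s\<^sup>2) has_real_derivative 2 * (fst z $ i + s)) (at s)"
        by (auto intro!: derivative_eq_intros)
      note DERIV_fun_exp[OF DERIV_minus[OF DERIV_cdivide[OF this, of "(slack z)\<^sup>2"]]]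
      from DERIV_mult[OF polyfun_DERIV[OF f x_axis_Basis, of z i s] DERIV_cmult[OF this, of P]]
      show ?thesis
        unfolding rho t by (rule DERIV_cong) (simp add: dx_def algebra_simps add_divide_distrib)
    qed
    then show "((\<lambda>s. f (z + s *\<^sub>R ?b) * rho \<kappa> 1 (z + s *\<^sub>R ?b)) has_vector_derivative
      (dx i f (z + s *\<^sub>R ?b) - 2 * (fst (z + s *\<^sub>R ?b) $ i / (slack (z + s *\<^sub>R ?b))\<^sup>2 * f (z + s *\<^sub>R ?b)))
      * rho \<kappa> 1 (z + s *\<^sub>R ?b)) (at s within {0..1})"
      by (simp add: has_real_derivative_iff_has_vector_derivative has_vector_derivative_at_within)
  qed simp
  then show "AE z in lborel. ((\<lambda>s. (dx i f (z + s *\<^sub>R ?b) - 2 * (fst (z + s *\<^sub>R ?b) $ i / (slack (z + s *\<^sub>R ?b))\<^sup>2 * f (z + s *\<^sub>R ?b)))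
      * rho \<kappa> 1 (z + s *\<^sub>R ?b)) has_integral
      (f (z + ?b) * rho \<kappa> 1 (z + ?b) - f z * rho \<kappa> 1 z)) {0..1}"
    by (simp del: scaleR_Pair)
qed

lemma AE_fst_nonzero: "AE z in (lborel :: ((real ^ 'd1::finite) \<times> (real ^ 'd2)) measure). fst z \<noteq> 0"
proof -
  have "AE z in (lborel :: (real ^ 'd1) measure) \<Otimes>\<^sub>M (lborel :: (real ^ 'd2) measure). fst z \<noteq> 0"
  proof (rule lborel_pair.AE_pair_measure)
    show "{z \<in> space ((lborel :: (real ^ 'd1) measure) \<Otimes>\<^sub>M (lborel :: (real ^ 'd2) measure)). fst z \<noteq> 0}
        \<in> sets (lborel \<Otimes>\<^sub>M lborel)" by measurable
  qed (rule AE_mp[OF AE_lborel_singleton[of 0]], simp)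
  then show ?thesis unfolding lborel_prod .
qed

text \<open>
  The integrand is the derivative of \<open>y\<^sub>j (1 - |y|) f\<close> times the density. The two factors in
  front of \<open>f\<close> make this product continuous across the two faces of the simplex that a line in direction \<open>y\<^sub>j\<close> meets. At the face
  \<open>|y| = 1\<close> this needs \<open>x \<noteq> 0\<close>, which holds almost everywhere.
\<close>

lemma integral_dy_rho:
  fixes f :: "(real ^ 'd1::finite) \<times> (real ^ 'd2) \<Rightarrow> real" and j :: 'd2
  assumes f: "polyfun f"
  shows "has_bochner_integral lborel (\<lambda>z. (slack z * snd z $ j * dy j f z + ((\<kappa> $ Some j + 1) * slack z - \<kappa> $ None * snd z $ j
    - 2 * ((norm (fst z))\<^sup>2 / (slack z)\<^sup>2) * snd z $ j) * f z) * rho \<kappa> 1 z) 0"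
    (is "has_bochner_integral lborel ?G 0")
proof -
  let ?b = "(0, axis j 1) :: (real ^ 'd1) \<times> (real ^ 'd2)"
  let ?F = "\<lambda>z. slack z * snd z $ j * f z * rho \<kappa> 1 z"
  show ?thesis
  proof (rule integral_zero_of_line_primitive[where F = ?F and b = ?b])
    show "integrable lborel ?F"
      by (intro integrable_polyfun_rho[OF \<kappa>] polyfun_intros f)
    have "integrable lborel (\<lambda>z. (slack z * snd z $ j * dy j f z + ((\<kappa> $ Some j + 1) * slack z - \<kappa> $ None * snd z $ j) * f z)
        * rho \<kappa> 1 z - 2 * ((norm (fst z))\<^sup>2 / (slack z)\<^sup>2 * (snd z $ j * f z) * rho \<kappa> 1 z))"
      by (intro Bochner_Integration.integrable_diff integrable_mult_right integrable_polyfun_rho[OF \<kappa>]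
          integrable_norm_polyfun_rho[OF \<kappa>] polyfun_intros f)
    then show "integrable lborel ?G"
      by (rule Bochner_Integration.integrable_cong[THEN iffD1, rotated -1]) (simp_all add: algebra_simps)
    show "AE z in lborel. ((\<lambda>s. ?G (z + s *\<^sub>R ?b)) has_integral (?F (z + ?b) - ?F z)) {0..1}"
      using AE_fst_nonzero
    proof eventually_elim
      case (elim z)
      define A where "A = (norm (fst z))\<^sup>2"
      have A: "A > 0" using elim by (simp add: A_def)
      define y where "y = snd z $ j"
      \<comment> \<open>The line parameter \<open>s\<close> enters \<open>rho\<close> only through \<open>y\<^sub>j = y + s\<close> and \<open>1 - |y| = slack z - s\<close>.\<close>
      define P where "P = (\<Prod>k\<in>UNIV - {j}. powpos (\<kappa> $ Some k) (snd z $ k))"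
      define \<alpha> where "\<alpha> = (\<lambda>r. r * powpos (\<kappa> $ Some j) r)"
      define \<beta> where "\<beta> = (\<lambda>r. r * powpos (\<kappa> $ None - 1) r * exp (- (A / r\<^sup>2)))"
      have t: "slack (z + s *\<^sub>R ?b) = slack z - s" for s
        by (simp add: slack_def ysum_def sum.distrib axis_def if_distrib[of "\<lambda>c. s * c"] cong: if_cong)
      have yj: "snd (z + s *\<^sub>R ?b) $ j = y + s" for s by (simp add: y_def)
      have rho: "rho \<kappa> 1 (z + s *\<^sub>R ?b) = P * powpos (\<kappa> $ Some j) (y + s)
          * (powpos (\<kappa> $ None - 1) (slack z - s) * exp (- (A / (slack z - s)\<^sup>2)))" for s
      proof -
        have "(\<Prod>k\<in>UNIV - {j}. powpos (\<kappa> $ Some k) (snd (z + s *\<^sub>R ?b) $ k)) = P"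
          unfolding P_def by (rule prod.cong) (auto simp: axis_def)
        then show ?thesis
          unfolding rho_def t by (subst prod.remove[of _ j]) (auto simp: yj[simplified] A_def)
      qed
      have F: "?F (z + s *\<^sub>R ?b) = f (z + s *\<^sub>R ?b) * P * (\<alpha> (y + s) * \<beta> (slack z - s))" for s
        unfolding rho t yj \<alpha>_def \<beta>_def by (simp add: mult_ac)
      have "((\<lambda>s. ?G (z + s *\<^sub>R ?b)) has_integral (?F (z + 1 *\<^sub>R ?b) - ?F (z + 0 *\<^sub>R ?b))) {0..1}"
      proof (rule fundamental_theorem_of_calculus_strong[where S = "{- y, slack z}"])
        show "continuous_on {0..1} (\<lambda>s. ?F (z + s *\<^sub>R ?b))"
          unfolding F \<alpha>_def \<beta>_def
          by (intro continuous_intros continuous_on_compose2[OF continuous_powpos[OF \<kappa>]]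
              continuous_on_compose2[OF continuous_powpos_gauss[OF A]]
              continuous_on_compose2[OF polyfun_continuous[OF f]]) auto
        fix s assume "s \<in> {0..1} - {- y, slack z}"
        then have s: "y + s \<noteq> 0" "slack z - s \<noteq> 0" by auto
        have "((\<lambda>s. ?F (z + s *\<^sub>R ?b)) has_real_derivative ?G (z + s *\<^sub>R ?b)) (at s)"
        proof -
          have a: "((\<lambda>s. \<alpha> (y + s)) has_real_derivative (\<kappa> $ Some j + 1) * powpos (\<kappa> $ Some j) (y + s)) (at s)"
            unfolding \<alpha>_def
            by (rule DERIV_cong[OF DERIV_chain2[where g = "\<lambda>s. y + s" and Db = 1, OF DERIV_powpos[OF s(1)]]])
              (auto intro!: derivative_eq_intros)
          have b: "((\<lambda>s. \<beta> (slack z - s)) has_real_derivative - ((\<kappa> $ None + 2 * (A / (slack z - s)\<^sup>2))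
              * (powpos (\<kappa> $ None - 1) (slack z - s) * exp (- (A / (slack z - s)\<^sup>2))))) (at s)"
            unfolding \<beta>_def
            by (rule DERIV_cong[OF DERIV_chain2[where g = "\<lambda>s. slack z - s" and Db = "-1",
                OF DERIV_powpos_gauss[OF s(2)]]])
              (auto intro!: derivative_eq_intros)
          from DERIV_mult[OF DERIV_mult[OF polyfun_DERIV[OF f y_axis_Basis, of z j s] DERIV_const[of P]] DERIV_mult[OF a b]]
          show ?thesis
            unfolding F
            by (rule DERIV_cong)
              (simp only: rho t yj dy_def[symmetric] \<alpha>_def \<beta>_def A_def[symmetric] fst_add fst_scaleR fst_conv
                scaleR_zero_right add_0_right, simp add: algebra_simps)
        qed
        then show "((\<lambda>s. ?F (z + s *\<^sub>R ?b)) has_vector_derivative ?G (z + s *\<^sub>R ?b)) (at s)"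
          by (simp only: has_real_derivative_iff_has_vector_derivative)
      qed auto
      then show ?case by (simp del: scaleR_Pair)
    qed
  qed
qed

definition rho_integral :: "((real ^ 'd1::finite) \<times> (real ^ 'd2) \<Rightarrow> real) \<Rightarrow> real" where
  "rho_integral f = (\<integral>z. f z * rho \<kappa> 1 z \<partial>lborel)"

lemma rho_integral_add:
  "polyfun f \<Longrightarrow> polyfun g \<Longrightarrow> rho_integral (\<lambda>z. f z + g z) = rho_integral f + rho_integral g"
  by (simp add: rho_integral_def distrib_right integrable_polyfun_rho[OF \<kappa>])

lemma rho_integral_cmult: "rho_integral (\<lambda>z. c * f z) = c * rho_integral f"
  by (simp add: rho_integral_def mult.assoc)

lemma rho_cases: "rho \<kappa> 1 z = 0 \<or> slack z > 0"
  using rho_neq_0_iff[of \<kappa> 1 z] by blast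

text \<open>
  The factor \<open>(1 - |y|)\<^sup>2\<close> clears the denominator in \<open>integral_dx_rho\<close>; where
  \<open>1 - |y| = 0\<close> the density vanishes.
\<close>

lemma rho_integral_dx:
  fixes f :: "(real ^ 'd1::finite) \<times> (real ^ 'd2) \<Rightarrow> real"
  assumes f: "polyfun f"
  shows "rho_integral (\<lambda>z. slack z ^ 2 * dx i f z - 2 * fst z $ i * f z) = 0"
proof -
  let ?f = "\<lambda>z. slack z ^ 2 * f z"
  have eq: "fst z $ i / (slack z)\<^sup>2 * ?f z * rho \<kappa> 1 z = fst z $ i * f z * rho \<kappa> 1 z" for z
    using rho_cases[of z] by auto
  have "has_bochner_integral lborel (\<lambda>z. (dx i ?f z - 2 * (fst z $ i / (slack z)\<^sup>2 * ?f z)) * rho \<kappa> 1 z) 0"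
    by (rule integral_dx_rho)
      (unfold eq, intro polyfun_intros f, intro integrable_polyfun_rho[OF \<kappa>] polyfun_intros f)
  also have "(\<lambda>z. (dx i ?f z - 2 * (fst z $ i / (slack z)\<^sup>2 * ?f z)) * rho \<kappa> 1 z)
    = (\<lambda>z. (slack z ^ 2 * dx i f z - 2 * fst z $ i * f z) * rho \<kappa> 1 z)"
    by (simp only: left_diff_distrib mult.assoc[of 2] eq) (simp add: dx_slack_power_mult f)
  finally show ?thesis by (simp add: rho_integral_def has_bochner_integral_iff)
qed

text \<open>
  The derivative at fixed \<open>x\<close> differs from the one at fixed \<open>x / (1 - |y|)\<close> by an Euler
  field in \<open>x\<close>. So the rule is that of \<open>integral_dy_rho\<close> minus the rules of
  \<open>integral_dx_rho\<close> for \<open>x\<^sub>i y\<^sub>j f\<close>, summed over \<open>i\<close>; the two terms in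
  \<open>\<parallel>x\<parallel>\<^sup>2 / (1 - |y|)\<^sup>2\<close> cancel and \<open>d\<^sub>1\<close> appears as the divergence of the
  Euler field.
\<close>

lemma rho_integral_dy:
  fixes f :: "(real ^ 'd1::finite) \<times> (real ^ 'd2) \<Rightarrow> real"
  assumes f: "polyfun f"
  shows "rho_integral (\<lambda>z. snd z $ j * scaled_dy j f z
      + ((\<kappa> $ Some j + 1) * slack z - (\<kappa> $ None + real CARD('d1)) * snd z $ j) * f z) = 0"
proof -
  let ?f = "\<lambda>i z. fst z $ i * (snd z $ j * f z)"
  have x: "has_bochner_integral lborel (\<lambda>z. (dx i (?f i) z - 2 * (fst z $ i / (slack z)\<^sup>2 * ?f i z)) * rho \<kappa> 1 z) 0" for i
  proof (rule integral_dx_rho)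
    show "integrable lborel (\<lambda>z. fst z $ i / (slack z)\<^sup>2 * ?f i z * rho \<kappa> 1 z)"
    proof (rule Bochner_Integration.integrable_bound)
      show "integrable lborel (\<lambda>z. (norm (fst z))\<^sup>2 / (slack z)\<^sup>2 * (snd z $ j * f z) * rho \<kappa> 1 z)"
        by (intro integrable_norm_polyfun_rho[OF \<kappa>] polyfun_intros f)
      have [measurable]: "f \<in> borel_measurable borel" by (rule polyfun_measurable[OF f])
      show "(\<lambda>z. fst z $ i / (slack z)\<^sup>2 * ?f i z * rho \<kappa> 1 z) \<in> borel_measurable lborel"
        by measurable
      show "AE z in lborel. norm (fst z $ i / (slack z)\<^sup>2 * ?f i z * rho \<kappa> 1 z)
        \<le> norm ((norm (fst z))\<^sup>2 / (slack z)\<^sup>2 * (snd z $ j * f z) * rho \<kappa> 1 z)"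
      proof (rule AE_I2)
        fix z :: "(real ^ 'd1) \<times> (real ^ 'd2)"
        have "\<bar>fst z $ i\<bar>\<^sup>2 / (slack z)\<^sup>2 \<le> (norm (fst z))\<^sup>2 / (slack z)\<^sup>2"
          by (intro divide_right_mono power_mono component_le_norm_cart) auto
        from mult_right_mono[OF this, of "\<bar>(snd z $ j * f z) * rho \<kappa> 1 z\<bar>"]
        show "norm (fst z $ i / (slack z)\<^sup>2 * ?f i z * rho \<kappa> 1 z)
          \<le> norm ((norm (fst z))\<^sup>2 / (slack z)\<^sup>2 * (snd z $ j * f z) * rho \<kappa> 1 z)"
          by (simp add: abs_mult power2_eq_square mult_ac del: abs_mult_self_eq add: abs_mult_self_eq[of "slack z"])
      qed
    qed
  qed (intro polyfun_intros f)
  have eq: "(slack z * snd z $ j * dy j f z + ((\<kappa> $ Some j + 1) * slack z - \<kappa> $ None * snd z $ j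
      - 2 * ((norm (fst z))\<^sup>2 / (slack z)\<^sup>2) * snd z $ j) * f z) * rho \<kappa> 1 z
      - (\<Sum>i\<in>UNIV. (dx i (?f i) z - 2 * (fst z $ i / (slack z)\<^sup>2 * ?f i z)) * rho \<kappa> 1 z)
    = (snd z $ j * scaled_dy j f z
      + ((\<kappa> $ Some j + 1) * slack z - (\<kappa> $ None + real CARD('d1)) * snd z $ j) * f z) * rho \<kappa> 1 z" for z
  proof -
    have dx: "dx i (?f i) z = snd z $ j * f z + snd z $ j * (fst z $ i * dx i f z)" for i
      by (simp add: dx_mult dx_fst_nth dx_snd_nth polyfun_fst_nth polyfun_snd_nth polyfun_mult f)
    have "(\<Sum>i\<in>UNIV. dx i (?f i) z - 2 * (fst z $ i / (slack z)\<^sup>2 * ?f i z))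
      = (\<Sum>i\<in>UNIV. snd z $ j * f z + snd z $ j * (fst z $ i * dx i f z)
          - 2 * (snd z $ j * f z) / (slack z)\<^sup>2 * (fst z $ i)\<^sup>2)"
      unfolding dx by (rule sum.cong) (simp_all add: power2_eq_square)
    also have "\<dots> = real CARD('d1) * (snd z $ j * f z) + snd z $ j * euler_x f z
          - 2 * (snd z $ j * f z) / (slack z)\<^sup>2 * (norm (fst z))\<^sup>2"
      unfolding sum.distrib sum_subtractf sum_distrib_left[symmetric] euler_x_def[symmetric]
      by (simp add: norm_vec_def L2_set_def sum_nonneg)
    finally have sum: "(\<Sum>i\<in>UNIV. dx i (?f i) z - 2 * (fst z $ i / (slack z)\<^sup>2 * ?f i z)) = \<dots>" .
    show ?thesis
      unfolding sum_distrib_right[symmetric] sum scaled_dy_def by (simp add: algebra_simps)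
  qed
  have "has_bochner_integral lborel (\<lambda>z. (snd z $ j * scaled_dy j f z
      + ((\<kappa> $ Some j + 1) * slack z - (\<kappa> $ None + real CARD('d1)) * snd z $ j) * f z) * rho \<kappa> 1 z)
      (0 - (\<Sum>i\<in>(UNIV :: 'd1 set). 0))"
    unfolding eq[symmetric]
    by (intro has_bochner_integral_diff has_bochner_integral_sum x integral_dy_rho f)
  then show ?thesis by (simp add: rho_integral_def has_bochner_integral_iff)
qed

text \<open>
  On the boundary of the simplex some base of a power is zero, so the weight vanishes there, as
  does \<open>rho\<close>; hence the identity holds at every point and not just almost everywhere.
\<close>

lemma rtri_weight_eq:
  fixes z :: "(real ^ 'd1::finite) \<times> (real ^ 'd2)"
  shows "indicator rtri z * rtri_weight \<kappa> z = slack z * rho \<kappa> 1 z"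
proof (cases "slack z > 0 \<and> (\<forall>i. snd z $ i > 0)")
  case True
  then have "z \<in> rtri"
    by (cases z) (auto simp: rtri_def simplex_dom_def slack_def less_imp_le)
  moreover have "slack z * slack z powr (\<kappa> $ None - 1) = slack z powr (\<kappa> $ None)"
    using True by (simp add: powr_diff)
  ultimately show ?thesis
    using True by (simp add: rho_def rtri_weight_def split_beta powpos_def slack_def[symmetric] mult_ac)
next
  case False
  then have "rho \<kappa> 1 z = 0" using rho_neq_0_iff by blast
  moreover have "rtri_weight \<kappa> z = 0" if "z \<in> rtri"
  proof -
    have "slack z = 0 \<or> (\<exists>i. snd z $ i = 0)"
      using that False by (cases z) (auto simp: rtri_def simplex_dom_def slack_def not_less intro: antisym)
    then show ?thesis by (auto simp: rtri_weight_def split_beta slack_def)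
  qed
  ultimately show ?thesis by (auto split: split_indicator)
qed

lemma weighted_inner_rtri:
  fixes f g :: "(real ^ 'd1::finite) \<times> (real ^ 'd2) \<Rightarrow> real"
  shows   "weighted_inner rtri (rtri_weight \<kappa>) f g = rho_integral (\<lambda>z. slack z * f z * g z)"
  unfolding weighted_inner_def set_lebesgue_integral_def rho_integral_def
proof (rule Bochner_Integration.integral_cong[OF refl])
  fix z :: "(real ^ 'd1) \<times> (real ^ 'd2)"
  have "indicat_real rtri z *\<^sub>R (f z * g z * rtri_weight \<kappa> z) = (f z * g z) * (indicator rtri z * rtri_weight \<kappa> z)"
    by simp
  then show "indicat_real rtri z *\<^sub>R (f z * g z * rtri_weight \<kappa> z) = slack z * f z * g z * rho \<kappa> 1 z"
    unfolding rtri_weight_eq by simp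
qed

text \<open>
  The integrand is nonnegative, so \<open>r\<close> vanishes almost everywhere on the interior of the
  domain, hence everywhere on it by continuity, hence identically.
\<close>

lemma rho_integral_definite:
  fixes r :: "(real ^ 'd1::finite) \<times> (real ^ 'd2) \<Rightarrow> real"
  assumes r: "polyfun r" and 0: "rho_integral (\<lambda>z. slack z * r z * r z) = 0"
  shows "r = (\<lambda>z. 0)"
proof -
  have nonneg: "0 \<le> slack z * r z * r z * rho \<kappa> 1 z" for z
  proof -
    have eq: "slack z * r z * r z * rho \<kappa> 1 z = slack z * rho \<kappa> 1 z * (r z)\<^sup>2"
      by (simp add: power2_eq_square)
    show ?thesis unfolding eq using rho_cases[of z] rho_nonneg[of \<kappa> 1 z] by auto
  qed
  have "integrable lborel (\<lambda>z. slack z * r z * r z * rho \<kappa> 1 z)"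
    by (intro integrable_polyfun_rho[OF \<kappa>] polyfun_intros r)
  then have ae: "AE z in lborel. slack z * r z * r z * rho \<kappa> 1 z = 0"
    using 0 nonneg by (subst (asm) rho_integral_def) (simp add: integral_nonneg_eq_0_iff_AE)
  define U :: "((real ^ 'd1) \<times> (real ^ 'd2)) set" where "U = {z. 0 < slack z} \<inter> (\<Inter>i. {z. 0 < snd z $ i})"
  have U: "open U"
    unfolding U_def by (intro open_Int open_INT finite ballI open_Collect_less
        polyfun_continuous polyfun_intros)
  define S where "S = U \<inter> {z. r z \<noteq> 0}"
  have S: "open S"
    unfolding S_def by (intro open_Int U open_Collect_neq polyfun_continuous[OF r] continuous_intros)
  have "AE z in lborel. z \<notin> S"
    using ae
  proof eventually_elim
    case (elim z)
    show ?case
    proof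
      assume "z \<in> S"
      then have "slack z > 0" "\<forall>i. snd z $ i > 0" "r z \<noteq> 0" by (auto simp: S_def U_def)
      moreover from this have "rho \<kappa> 1 z \<noteq> 0" by (simp add: rho_neq_0_iff)
      ultimately show False using elim by simp
    qed
  qed
  then have "S \<in> null_sets lborel"
    using S by (subst (asm) AE_iff_null_sets[symmetric]) auto
  then have "negligible S"
    by (simp add: negligible_iff_null_sets null_sets_completionI)
  then have "S = {}" using open_not_negligible[OF S] by blast
  then have "r z = 0" if "z \<in> U" for z using that by (auto simp: S_def)
  moreover have "(0, \<chi> i. 1 / (real CARD('d2) + 1)) \<in> U"
    by (auto simp: U_def slack_def ysum_def field_simps)
  ultimately show ?thesis using polyfun_zero_on_open[OF r U] by blast
qed

end

section \<open>The eigenvalue equation\<close>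

theorem theorem6p2:
  fixes \<kappa> :: "real ^ ('d2::finite option)"
    and n :: nat
    and u :: "(real ^ 'd1::finite) \<times> (real ^ 'd2) \<Rightarrow> real"
  assumes "\<And>j. \<kappa> $ j > -1"
    and "u \<in> orth_polys n rtri (rtri_weight \<kappa>)"
  shows "rtri_op \<kappa> u =
    (\<lambda>z. - real n * (real n + kappa_sum \<kappa> + real CARD('d1) + real CARD('d2)) * u z)"
proof -
  note \<kappa> = assms(1)
  define M where "M = (rho_integral \<kappa> :: ((real ^ 'd1) \<times> (real ^ 'd2) \<Rightarrow> real) \<Rightarrow> real)"
  define ev where "ev = real n * (real n + kappa_sum \<kappa> + real CARD('d1) + real CARD('d2))"
  \<comment> \<open>The defect of the eigenvalue equation; it has degree below \<open>n\<close> and is orthogonal to itself.\<close>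
  define r where "r = (\<lambda>z. rtri_op \<kappa> u z + ev * u z)"
  have u: "poly_deg (int n) u" using orth_polys_poly_deg[OF assms(2)] .
  have r: "poly_deg (int n - 1) r"
    using rtri_op_leading_part[OF u, of \<kappa>] by (simp add: r_def ev_def)
  have Dr: "poly_deg (int n - 1) (rtri_op \<kappa> r)"
  proof -
    define e where "e = of_int (int n - 1) * (of_int (int n - 1) + kappa_sum \<kappa> + real CARD('d1) + real CARD('d2))"
    have "poly_deg (int n - 1) (\<lambda>z. rtri_op \<kappa> r z + e * r z)"
      using rtri_op_leading_part[OF r, of \<kappa>] unfolding e_def by (rule poly_deg_mono) simp
    from poly_deg_diff[OF this poly_deg_cmult[OF r, of e]] show ?thesis by simp
  qed
  have orth: "M (\<lambda>z. slack z * u z * v z) = 0" if "poly_deg (int n - 1) v" for v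
    using orth_polys_orthogonal[OF assms(2) that] by (simp add: weighted_inner_rtri[OF \<kappa>] M_def)
  have pu: "polyfun u" and pr: "polyfun r" and pDr: "polyfun (rtri_op \<kappa> r)"
    using u r Dr by (auto intro: polyfunI)
  have Du: "polyfun (rtri_op \<kappa> u)"
    using polyfun_diff[OF pr polyfun_mult[OF polyfun_const[of ev] pu]] by (simp add: r_def)
  have "M (\<lambda>z. slack z * rtri_op \<kappa> u z * r z) = M (\<lambda>z. slack z * rtri_op \<kappa> r z * u z)"
    unfolding M_def
    by (rule M_rtri_op_sym[OF rho_integral_add[OF \<kappa>] rho_integral_cmult[OF \<kappa>] rho_integral_dx[OF \<kappa>]
        rho_integral_dy[OF \<kappa>] pu pr])
  also have "\<dots> = 0"
    using orth[OF Dr] by (simp add: mult_ac)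
  finally have "M (\<lambda>z. slack z * rtri_op \<kappa> u z * r z) + ev * M (\<lambda>z. slack z * u z * r z) = 0"
    using orth[OF r] by simp
  moreover have "M (\<lambda>z. slack z * rtri_op \<kappa> u z * r z + ev * (slack z * u z * r z))
    = M (\<lambda>z. slack z * rtri_op \<kappa> u z * r z) + ev * M (\<lambda>z. slack z * u z * r z)"
    unfolding M_def rho_integral_cmult[OF \<kappa>, symmetric]
    by (intro rho_integral_add[OF \<kappa>] polyfun_intros pu pr Du)
  moreover have "(\<lambda>z. slack z * rtri_op \<kappa> u z * r z + ev * (slack z * u z * r z)) = (\<lambda>z. slack z * r z * r z)"
    by (auto simp: r_def algebra_simps)
  ultimately have "r = (\<lambda>z. 0)"
    using rho_integral_definite[OF \<kappa> pr] by (simp add: M_def)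
  then show ?thesis
    by (auto simp: r_def ev_def fun_eq_iff add_eq_0_iff2)
qed

end
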